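(* Let $\nabla$ be an $h$-connection of $E$ and $\varepsilon\in\{+,-\}$. The topological holonomy group $G_{\hat\nabla,\varepsilon}\subset SO(3)$ is given by one of the following: (a) a finite group; (b) a commutative infinite group which is generated by one or two elements, and dense in a subgroup of $SO(3)$ isomorphic to $SO(2)$; (c) a noncommutative infinite group generated by two elements of order $2$ and $\infty$ respectively, such that their rotation axes are orthogonal; (d) a noncommutative infinite group which is dense in $SO(3)$.
   Context: Let $T^2=S^1\times S^1$ with $S^1=\mathbb{R}/2\pi\mathbb{Z}$ and let $\mathrm{pr}:\mathbb{R}^2\to T^2$ be the projection. $E$ is an oriented real vector bundle of rank 4 over $T^2$ with a positive-definite metric $h$. An $h$-connection is a connection $\nabla$ of $E$ with $\nabla h=0$. $\bigwedge^2E$ with the induced metric $\hat h$ decomposes into rank 3 subbundles $\bigwedge^2_+E\oplus\bigwedge^2_-E$: for a local positively oriented orthonormal frame $(e_1,e_2,e_3,e_4)$ of $E$, $\bigwedge^2_\pm E$ has the local orthonormal frame $\Omega_{\pm,1}=\frac1{\sqrt2}(e_1\wedge e_2\pm e_3\wedge e_4)$, $\Omega_{\pm,2}=\frac1{\sqrt2}(e_1\wedge e_3\pm e_4\wedge e_2)$, $\Omega_{\pm,3}=\frac1{\sqrt2}(e_1\wedge e_4\pm e_2\wedge e_3)$, and is oriented by it. $\nabla$ induces an $\hat h$-connection $\hat\nabla$ of $\bigwedge^2E$, which restricts to $\bigwedge^2_\pm E$. For $\varepsilon\in\{+,-\}$ fix a positively oriented orthonormal basis $(\omega_{\varepsilon,1},\omega_{\varepsilon,2},\omega_{\varepsilon,3})$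 of the fiber of $\bigwedge^2_\varepsilon E$ at $\mathrm{pr}(0,0)$. Let $\tilde\Omega_{\varepsilon,i,x}$ (resp. $\tilde\Omega_{\varepsilon,i,y}$) be the $\hat\nabla$-parallel sections of $\mathrm{pr}^*\bigwedge^2_\varepsilon E$ along the $x$-axis (resp. $y$-axis) with value $\omega_{\varepsilon,i}$ at $(0,0)$. Identifying the fibers of the pull-back at $(x+2\pi m,y+2\pi n)$ and $(x,y)$ for $m,n\in\mathbb{Z}$, there are $C_{\varepsilon,1},C_{\varepsilon,2}\in SO(3)$ such that for all $a,b\in\mathbb{R}$: $(\tilde\Omega_{\varepsilon,i,x}(a+2\pi,0))_{i=1,2,3}=(\tilde\Omega_{\varepsilon,i,x}(a,0))_{i=1,2,3}\,C_{\varepsilon,1}$ and $(\tilde\Omega_{\varepsilon,i,y}(0,b+2\pi))_{i=1,2,3}=(\tilde\Omega_{\varepsilon,i,y}(0,b))_{i=1,2,3}\,C_{\varepsilon,2}$ (row vectors times matrices). The topological holonomy group $G_{\hat\nabla,\varepsilon}$ of $\hat\nabla$ in $\bigwedge^2_\varepsilon E$ at $\mathrm{pr}(0,0)$ is the subgroup of $SO(3)$ generated by $C_{\varepsilon,1},C_{\varepsilon,2}$. The rotation axis of a non-identity element of $SO(3)$ is its eigenspace for the eigenvalue $1$. *)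

theory Defs
  imports "HOL-Analysis.Analysis" "HOL-Algebra.Generated_Groups" "HOL-Algebra.Multiplicative_Group"
begin

section \<open>The torus\<close>

quotient_type circle = real / "\<lambda>x y. \<exists>k::int. y = x + 2 * pi * of_int k"
proof (rule equivpI)
  show "reflp (\<lambda>x y. \<exists>k::int. y = x + 2 * pi * of_int k)"
    by (rule reflpI) (rule exI[of _ 0], simp)
  show "symp (\<lambda>x y. \<exists>k::int. y = x + 2 * pi * of_int k)"
    by (rule sympI, elim exE) (rule_tac x = "- k" in exI, simp)
  show "transp (\<lambda>x y. \<exists>k::int. y = x + 2 * pi * of_int k)"
    by (rule transpI, elim exE) (rule_tac x = "k + ka" in exI, simp add: algebra_simps)
qed

instantiation circle :: topological_space
begin

definition open_circle_def: "open U \<longleftrightarrow> open (abs_circle -` U)" for U :: "circle set"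

instance
proof
  show "open (UNIV :: circle set)"
    by (simp add: open_circle_def)
next
  fix S T :: "circle set"
  assume "open S" "open T"
  then show "open (S \<inter> T)"
    by (simp add: open_circle_def open_Int)
next
  fix K :: "circle set set"
  assume "\<forall>S\<in>K. open S"
  then show "open (\<Union>K)"
    by (auto simp: open_circle_def vimage_Union intro!: open_UN)
qed

end

type_synonym torus = "circle \<times> circle"

definition pr :: "real \<times> real \<Rightarrow> torus" where
  "pr x = (abs_circle (fst x), abs_circle (snd x))"

text \<open>\<open>C\<^sup>k\<close> functions on an open subset of a Euclidean space, by recursion on the
  partial derivatives.\<close>

primrec Ck_on :: "nat \<Rightarrow> 'a::euclidean_space set \<Rightarrow> ('a \<Rightarrow> real) \<Rightarrow> bool" where
  "Ck_on 0 S f \<longleftrightarrow> continuous_on S f"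
| "Ck_on (Suc k) S f \<longleftrightarrow>
     (\<exists>g. (\<forall>x\<in>S. (f has_derivative (\<lambda>v. \<Sum>b\<in>Basis. (v \<bullet> b) * g b x)) (at x)) \<and>
          (\<forall>b\<in>Basis. Ck_on k S (g b)))"

definition smooth_on :: "'a::euclidean_space set \<Rightarrow> ('a \<Rightarrow> real) \<Rightarrow> bool" where
  "smooth_on S f \<longleftrightarrow> (\<forall>k. Ck_on k S f)"

text \<open>As \<^term>\<open>pr\<close> is a covering map that defines the smooth structure of the torus, smoothness is
  tested upstairs; likewise each tangent space of the torus is identified with \<open>\<real>\<^sup>2\<close> by the
  differential of \<^term>\<open>pr\<close>.\<close>

definition smooth_fun :: "torus set \<Rightarrow> (torus \<Rightarrow> real) \<Rightarrow> bool" where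
  "smooth_fun U f \<longleftrightarrow> smooth_on (pr -` U) (f \<circ> pr)"

section \<open>Vector bundles and connections over the torus\<close>

text \<open>A family of vector spaces \<open>fiber p\<close> (subspaces of one carrier space, whose linear structure
  they borrow; nothing relates different fibers, so that any family of vector spaces can be
  presented in this way) with an atlas of local frames \<open>(U, e)\<close>, i.e. of local
  trivializations over \<open>U\<close>. The frames are indexed by the set \<open>index\<close>.\<close>

record ('i, 'v) vbundle =
  fiber :: "torus \<Rightarrow> 'v set"
  index :: "'i set"
  frames :: "(torus set \<times> ('i \<Rightarrow> torus \<Rightarrow> 'v)) set"

definition smooth_section ::
    "('i, 'v::real_vector) vbundle \<Rightarrow> torus set \<Rightarrow> (torus \<Rightarrow> 'v) \<Rightarrow> bool" where
  "smooth_section B U s \<longleftrightarrow>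
     (\<forall>p\<in>U. s p \<in> fiber B p) \<and>
     (\<forall>(V, e)\<in>frames B. \<exists>a. (\<forall>i\<in>index B. smooth_fun (U \<inter> V) (a i)) \<and>
        (\<forall>p\<in>U \<inter> V. s p = (\<Sum>i\<in>index B. a i p *\<^sub>R e i p)))"

definition section_near ::
    "('i, 'v::real_vector) vbundle \<Rightarrow> torus \<Rightarrow> (torus \<Rightarrow> 'v) \<Rightarrow> bool" where
  "section_near B p s \<longleftrightarrow> (\<exists>U. open U \<and> p \<in> U \<and> smooth_section B U s)"

text \<open>The last clause says that the transition functions between frames are smooth.\<close>

definition vector_bundle :: "('i, 'v::real_vector) vbundle \<Rightarrow> bool" where
  "vector_bundle B \<longleftrightarrow>
     finite (index B) \<and>
     (\<forall>p. subspace (fiber B p)) \<and>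
     (\<forall>p. \<exists>(U, e)\<in>frames B. p \<in> U) \<and>
     (\<forall>(U, e)\<in>frames B. open U \<and>
        (\<forall>p\<in>U. inj_on (\<lambda>i. e i p) (index B) \<and>
               independent ((\<lambda>i. e i p) ` index B) \<and>
               span ((\<lambda>i. e i p) ` index B) = fiber B p) \<and>
        (\<forall>i\<in>index B. smooth_section B U (e i)))"

text \<open>A connection as an operator on local sections: \<open>D p v s\<close> is \<open>(\<nabla>\<^sub>v s)(p)\<close> for a section
  \<open>s\<close> that is smooth near \<open>p\<close> and a tangent vector \<open>v\<close> at \<open>p\<close>. No condition is put on \<open>D p v s\<close>
  for other \<open>s\<close>.\<close>

type_synonym 'v connection = "torus \<Rightarrow> real \<times> real \<Rightarrow> (torus \<Rightarrow> 'v) \<Rightarrow> 'v"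

definition connection :: "('i, 'v::real_vector) vbundle \<Rightarrow> 'v connection \<Rightarrow> bool" where
  "connection B D \<longleftrightarrow>
     (\<forall>p v s. section_near B p s \<longrightarrow> D p v s \<in> fiber B p) \<and>
     (\<forall>p s. section_near B p s \<longrightarrow> linear (\<lambda>v. D p v s)) \<and>
     (\<forall>p v s t. section_near B p s \<longrightarrow> section_near B p t \<longrightarrow>
        D p v (\<lambda>q. s q + t q) = D p v s + D p v t) \<and>
     (\<forall>x v f s U. open U \<longrightarrow> pr x \<in> U \<longrightarrow> smooth_fun U f \<longrightarrow> smooth_section B U s \<longrightarrow>
        D (pr x) v (\<lambda>q. f q *\<^sub>R s q) =
          frechet_derivative (f \<circ> pr) (at x) v *\<^sub>R s (pr x) + f (pr x) *\<^sub>R D (pr x) v s) \<and>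
     (\<forall>p v s t U. open U \<longrightarrow> p \<in> U \<longrightarrow> smooth_section B U s \<longrightarrow> (\<forall>q\<in>U. s q = t q) \<longrightarrow>
        D p v s = D p v t) \<and>
     (\<forall>U v s. open U \<longrightarrow> smooth_section B U s \<longrightarrow> smooth_section B U (\<lambda>q. D q v s))"

text \<open>Parallel sections of the pull-back of \<open>B\<close> along the line \<open>t \<mapsto> pr (t v)\<close>: writing
  \<open>\<sigma> t = \<Sum>\<^sub>i a\<^sub>i(t) e\<^sub>i\<close> in a local frame, the covariant derivative is
  \<open>\<Sum>\<^sub>i (a\<^sub>i'(t) e\<^sub>i + a\<^sub>i(t) \<nabla>\<^sub>v e\<^sub>i)\<close>.\<close>

definition parallel_along ::
    "('i, 'v::real_vector) vbundle \<Rightarrow> 'v connection \<Rightarrow> real \<times> real \<Rightarrow> (real \<Rightarrow> 'v) \<Rightarrow> bool" where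
  "parallel_along B D v \<sigma> \<longleftrightarrow>
     (\<forall>t. \<sigma> t \<in> fiber B (pr (t *\<^sub>R v))) \<and>
     (\<forall>(U, e)\<in>frames B. \<exists>a a'. \<forall>t. pr (t *\<^sub>R v) \<in> U \<longrightarrow>
        \<sigma> t = (\<Sum>i\<in>index B. a i t *\<^sub>R e i (pr (t *\<^sub>R v))) \<and>
        (\<forall>i\<in>index B. (a i has_real_derivative a' i t) (at t)) \<and>
        (\<Sum>i\<in>index B. a' i t *\<^sub>R e i (pr (t *\<^sub>R v)) + a i t *\<^sub>R D (pr (t *\<^sub>R v)) v (e i)) = 0)"

section \<open>Oriented rank 4 bundles with a metric\<close>

text \<open>Row vector of vectors times matrix.\<close>

definition frame_mult :: "('n::finite \<Rightarrow> 'v::real_vector) \<Rightarrow> real^'n^'n \<Rightarrow> 'n \<Rightarrow> 'v" where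
  "frame_mult b g j = (\<Sum>i\<in>UNIV. (g $ i $ j) *\<^sub>R b i)"

text \<open>The orientation is given by an oriented atlas: its frames are the positively oriented
  ones.\<close>

definition oriented_bundle4 :: "(4, 'v::real_vector) vbundle \<Rightarrow> bool" where
  "oriented_bundle4 E \<longleftrightarrow>
     vector_bundle E \<and> index E = UNIV \<and>
     (\<forall>(U, e)\<in>frames E. \<forall>(V, f)\<in>frames E. \<forall>p\<in>U \<inter> V. \<forall>g.
        (\<lambda>j. f j p) = frame_mult (\<lambda>i. e i p) g \<longrightarrow> det g > 0)"

definition positive_basis :: "(4, 'v::real_vector) vbundle \<Rightarrow> torus \<Rightarrow> (4 \<Rightarrow> 'v) \<Rightarrow> bool" where
  "positive_basis E p b \<longleftrightarrow>
     (\<exists>(U, e)\<in>frames E. p \<in> U \<and> (\<exists>g. det g > 0 \<and> b = frame_mult (\<lambda>i. e i p) g))"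

definition bilinear_on :: "'v::real_vector set \<Rightarrow> ('v \<Rightarrow> 'v \<Rightarrow> real) \<Rightarrow> bool" where
  "bilinear_on V b \<longleftrightarrow>
     (\<forall>x\<in>V. \<forall>y\<in>V. \<forall>z\<in>V. b (x + y) z = b x z + b y z \<and> b z (x + y) = b z x + b z y) \<and>
     (\<forall>c. \<forall>x\<in>V. \<forall>y\<in>V. b (c *\<^sub>R x) y = c * b x y \<and> b x (c *\<^sub>R y) = c * b x y)"

type_synonym 'v metric = "torus \<Rightarrow> 'v \<Rightarrow> 'v \<Rightarrow> real"

definition bundle_metric :: "('i, 'v::real_vector) vbundle \<Rightarrow> 'v metric \<Rightarrow> bool" where
  "bundle_metric B h \<longleftrightarrow>
     (\<forall>p. bilinear_on (fiber B p) (h p) \<and>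
          (\<forall>u\<in>fiber B p. \<forall>w\<in>fiber B p. h p u w = h p w u) \<and>
          (\<forall>u\<in>fiber B p. u \<noteq> 0 \<longrightarrow> h p u u > 0)) \<and>
     (\<forall>(U, e)\<in>frames B. \<forall>i\<in>index B. \<forall>j\<in>index B. smooth_fun U (\<lambda>p. h p (e i p) (e j p)))"

text \<open>\<open>\<nabla>h = 0\<close>.\<close>

definition metric_connection ::
    "('i, 'v::real_vector) vbundle \<Rightarrow> 'v metric \<Rightarrow> 'v connection \<Rightarrow> bool" where
  "metric_connection B h D \<longleftrightarrow>
     connection B D \<and>
     (\<forall>x v s t. section_near B (pr x) s \<longrightarrow> section_near B (pr x) t \<longrightarrow>
        frechet_derivative ((\<lambda>q. h q (s q) (t q)) \<circ> pr) (at x) v =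
          h (pr x) (D (pr x) v s) (t (pr x)) + h (pr x) (s (pr x)) (D (pr x) v t))"

definition orthonormal :: "('v \<Rightarrow> 'v \<Rightarrow> real) \<Rightarrow> ('n \<Rightarrow> 'v) \<Rightarrow> bool" where
  "orthonormal b e \<longleftrightarrow> (\<forall>i j. b (e i) (e j) = (if i = j then 1 else 0))"

section \<open>The exterior square\<close>

text \<open>The exterior square of a vector space \<open>V\<close>, realized as the space of alternating bilinear forms
  on the dual of \<open>V\<close> spanned by
  \<open>(u \<and> w)(\<alpha>, \<beta>) = \<alpha>(u) \<beta>(w) - \<alpha>(w) \<beta>(u)\<close>. As linear functionals extend from subspaces, the
  exterior square of a subspace \<open>F\<close> is the span of the \<open>u \<and> w\<close> with \<open>u, w \<in> F\<close>.\<close>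

definition wedge_form ::
    "'v::real_vector \<times> 'v \<Rightarrow> ('v \<Rightarrow> real) \<Rightarrow> ('v \<Rightarrow> real) \<Rightarrow> real" where
  "wedge_form x \<alpha> \<beta> =
     (if linear \<alpha> \<and> linear \<beta> then \<alpha> (fst x) * \<beta> (snd x) - \<alpha> (snd x) * \<beta> (fst x) else 0)"

typedef (overloaded) 'v ext2 =
  "{B :: ('v::real_vector \<Rightarrow> real) \<Rightarrow> ('v \<Rightarrow> real) \<Rightarrow> real.
      \<exists>xs. B = (\<lambda>\<alpha> \<beta>. \<Sum>x\<leftarrow>xs. wedge_form x \<alpha> \<beta>)}"
  by blast

setup_lifting type_definition_ext2

lemma wedge_form_scale: "wedge_form (c *\<^sub>R fst x, snd x) \<alpha> \<beta> = c * wedge_form x \<alpha> \<beta>"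
  by (simp add: wedge_form_def linear_scale algebra_simps)

instantiation ext2 :: (real_vector) real_vector
begin

lift_definition zero_ext2 :: "'a ext2" is "\<lambda>\<alpha> \<beta>. 0"
  by (rule exI[of _ "[]"]) simp

lift_definition plus_ext2 :: "'a ext2 \<Rightarrow> 'a ext2 \<Rightarrow> 'a ext2" is "\<lambda>A B \<alpha> \<beta>. A \<alpha> \<beta> + B \<alpha> \<beta>"
  by (elim exE, rule_tac x = "xs @ xsa" in exI) simp

lift_definition scaleR_ext2 :: "real \<Rightarrow> 'a ext2 \<Rightarrow> 'a ext2" is "\<lambda>c A \<alpha> \<beta>. c * A \<alpha> \<beta>"
  subgoal for c A
    by (elim exE, rule_tac x = "map (\<lambda>x. (c *\<^sub>R fst x, snd x)) xs" in exI)
       (simp add: o_def wedge_form_scale sum_list_const_mult)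
  done

definition uminus_ext2 :: "'a ext2 \<Rightarrow> 'a ext2" where
  "uminus_ext2 A = (- 1) *\<^sub>R A"

definition minus_ext2 :: "'a ext2 \<Rightarrow> 'a ext2 \<Rightarrow> 'a ext2" where
  "minus_ext2 A B = A + (- B)"

instance
proof
  fix a b :: real and x y z :: "'a ext2"
  show "x + y + z = x + (y + z)" "x + y = y + x" "0 + x = x"
    by (transfer; simp add: fun_eq_iff)+
  show "- x + x = 0" "x - y = x + - y"
    unfolding uminus_ext2_def minus_ext2_def by (transfer; simp add: fun_eq_iff)+
  show "a *\<^sub>R (x + y) = a *\<^sub>R x + a *\<^sub>R y" "(a + b) *\<^sub>R x = a *\<^sub>R x + b *\<^sub>R x"
    "a *\<^sub>R b *\<^sub>R x = (a * b) *\<^sub>R x" "1 *\<^sub>R x = x"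
    by (transfer; simp add: fun_eq_iff algebra_simps)+
qed

end

lift_definition wedge :: "'v::real_vector \<Rightarrow> 'v \<Rightarrow> 'v ext2" is "\<lambda>u w. wedge_form (u, w)"
  subgoal for u w
    by (rule exI[of _ "[(u, w)]"]) simp
  done

lemma wedge_self: "wedge u u = 0"
  by transfer (simp add: wedge_form_def fun_eq_iff)

lemma wedge_add_left: "wedge (u + u') w = wedge u w + wedge u' w"
  by transfer (simp add: wedge_form_def fun_eq_iff linear_add algebra_simps)

lemma wedge_add_right: "wedge u (w + w') = wedge u w + wedge u w'"
  by transfer (simp add: wedge_form_def fun_eq_iff linear_add algebra_simps)

lemma wedge_scale_left: "wedge (c *\<^sub>R u) w = c *\<^sub>R wedge u w"
  by transfer (simp add: wedge_form_def fun_eq_iff linear_scale algebra_simps)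

lemma wedge_scale_right: "wedge u (c *\<^sub>R w) = c *\<^sub>R wedge u w"
  by transfer (simp add: wedge_form_def fun_eq_iff linear_scale algebra_simps)

text \<open>The order of \<^typ>\<open>4\<close> (in which \<open>4 = 0\<close> is the least element) only serves to select one of
  \<open>e\<^sub>i \<and> e\<^sub>j\<close> and \<open>e\<^sub>j \<and> e\<^sub>i\<close>.\<close>

definition ext2_bundle :: "(4, 'v::real_vector) vbundle \<Rightarrow> (4 \<times> 4, 'v ext2) vbundle" where
  "ext2_bundle E =
     \<lparr>fiber = (\<lambda>p. span {wedge u w | u w. u \<in> fiber E p \<and> w \<in> fiber E p}),
      index = {(i, j). i < j},
      frames = (\<lambda>(U, e). (U, \<lambda>(i, j) p. wedge (e i p) (e j p))) ` frames E\<rparr>"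

definition induced_metric ::
    "(4, 'v::real_vector) vbundle \<Rightarrow> 'v metric \<Rightarrow> 'v ext2 metric \<Rightarrow> bool" where
  "induced_metric E h hh \<longleftrightarrow>
     (\<forall>p. bilinear_on (fiber (ext2_bundle E) p) (hh p) \<and>
          (\<forall>u\<in>fiber E p. \<forall>w\<in>fiber E p. \<forall>u'\<in>fiber E p. \<forall>w'\<in>fiber E p.
             hh p (wedge u w) (wedge u' w') = h p u u' * h p w w' - h p u w' * h p w u'))"

definition induced_connection ::
    "(4, 'v::real_vector) vbundle \<Rightarrow> 'v connection \<Rightarrow> 'v ext2 connection \<Rightarrow> bool" where
  "induced_connection E D DD \<longleftrightarrow>
     connection (ext2_bundle E) DD \<and>
     (\<forall>p v s t. section_near E p s \<longrightarrow> section_near E p t \<longrightarrow>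
        DD p v (\<lambda>q. wedge (s q) (t q)) = wedge (D p v s) (t p) + wedge (s p) (D p v t))"

section \<open>The two halves of the exterior square\<close>

text \<open>The sign \<open>\<epsilon>\<close> is the real number \<open>1\<close> or \<open>-1\<close>.\<close>

definition Omega :: "real \<Rightarrow> (4 \<Rightarrow> 'v::real_vector) \<Rightarrow> 3 \<Rightarrow> 'v ext2" where
  "Omega \<epsilon> e k = (1 / sqrt 2) *\<^sub>R
     (if k = 1 then wedge (e 1) (e 2) + \<epsilon> *\<^sub>R wedge (e 3) (e 4)
      else if k = 2 then wedge (e 1) (e 3) + \<epsilon> *\<^sub>R wedge (e 4) (e 2)
      else wedge (e 1) (e 4) + \<epsilon> *\<^sub>R wedge (e 2) (e 3))"

definition ext2_half ::
    "(4, 'v::real_vector) vbundle \<Rightarrow> 'v metric \<Rightarrow> real \<Rightarrow> torus \<Rightarrow> 'v ext2 set" where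
  "ext2_half E h \<epsilon> p =
     span {Omega \<epsilon> e k | e k. positive_basis E p e \<and> orthonormal (h p) e}"

definition positive_orthonormal_half_basis ::
    "(4, 'v::real_vector) vbundle \<Rightarrow> 'v metric \<Rightarrow> 'v ext2 metric \<Rightarrow> real \<Rightarrow> torus \<Rightarrow>
       (3 \<Rightarrow> 'v ext2) \<Rightarrow> bool" where
  "positive_orthonormal_half_basis E h hh \<epsilon> p \<omega> \<longleftrightarrow>
     (\<forall>i. \<omega> i \<in> ext2_half E h \<epsilon> p) \<and> orthonormal (hh p) \<omega> \<and>
     (\<exists>e. positive_basis E p e \<and> orthonormal (h p) e \<and>
          (\<exists>g. det g > 0 \<and> \<omega> = frame_mult (Omega \<epsilon> e) g))"

section \<open>Special orthogonal groups and the topological holonomy group\<close>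

definition SO :: "(real^'n^'n) monoid" where
  "SO = \<lparr>carrier = {A. rotation_matrix A}, mult = (**), one = mat 1\<rparr>"

lemma group_SO: "group (SO :: (real^'n^'n) monoid)"
proof (rule groupI)
  fix A :: "real^'n^'n"
  assume "A \<in> carrier SO"
  then have "rotation_matrix A"
    by (simp add: SO_def)
  then have "rotation_matrix (transpose A)" "transpose A ** A = mat 1"
    by (auto simp: rotation_matrix_def orthogonal_matrix_def det_transpose transpose_transpose)
  then show "\<exists>B\<in>carrier SO. B \<otimes>\<^bsub>SO\<^esub> A = \<one>\<^bsub>SO\<^esub>"
    by (auto simp: SO_def)
qed (auto simp: SO_def rotation_matrix_def orthogonal_matrix_mul det_mul orthogonal_matrix_id
       matrix_mul_assoc)

definition rotation_axis :: "real^3^3 \<Rightarrow> (real^3) set" where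
  "rotation_axis A = {v. A *v v = v}"

text \<open>The pull-back of \<open>\<And>\<^sup>2E\<close> has the same fiber \<open>fiber (ext2_bundle E) (pr x)\<close> at \<open>x\<close> and at
  \<open>x + (2\<pi>m, 2\<pi>n)\<close>, so the identification of these fibers is the identity. \<open>\<Omega>x t\<close> and \<open>\<Omega>y t\<close> are
  the parallel frames at \<open>(t, 0)\<close> and \<open>(0, t)\<close>.\<close>

definition topological_holonomy_group ::
    "(4, 'v::real_vector) vbundle \<Rightarrow> 'v metric \<Rightarrow> 'v ext2 connection \<Rightarrow> real \<Rightarrow> (3 \<Rightarrow> 'v ext2) \<Rightarrow>
       (real^3^3) set \<Rightarrow> bool" where
  "topological_holonomy_group E h DD \<epsilon> \<omega> G \<longleftrightarrow>
     (\<exists>\<Omega>x \<Omega>y C1 C2.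
        (\<forall>i t. \<Omega>x t i \<in> ext2_half E h \<epsilon> (pr (t, 0))) \<and>
        (\<forall>i t. \<Omega>y t i \<in> ext2_half E h \<epsilon> (pr (0, t))) \<and>
        (\<forall>i. parallel_along (ext2_bundle E) DD (1, 0) (\<lambda>t. \<Omega>x t i)) \<and>
        (\<forall>i. parallel_along (ext2_bundle E) DD (0, 1) (\<lambda>t. \<Omega>y t i)) \<and>
        \<Omega>x 0 = \<omega> \<and> \<Omega>y 0 = \<omega> \<and>
        C1 \<in> carrier SO \<and> C2 \<in> carrier SO \<and>
        (\<forall>a. \<Omega>x (a + 2 * pi) = frame_mult (\<Omega>x a) C1) \<and>
        (\<forall>b. \<Omega>y (b + 2 * pi) = frame_mult (\<Omega>y b) C2) \<and>
        G = generate SO {C1, C2})"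

end

theory Submission
  imports Defs
begin

text \<open>The topological holonomy group is generated by the two elements \<open>C\<^sub>1, C\<^sub>2\<close> of \<open>SO(3)\<close>, so
  the four cases are a classification of the subgroups \<open>G\<close> of \<open>SO(3)\<close> with two generators.

  Suppose that \<open>G\<close> is infinite. As \<open>SO(3)\<close> is compact, \<open>G\<close> has elements other than \<open>1\<close>
  arbitrarily close to \<open>1\<close>. They are rotations by small angles, and along a subsequence their axes
  converge to a line \<open>\<real>u\<close>. Suitable powers of them approximate every rotation about \<open>u\<close>: the closure
  of \<open>G\<close> contains the whole circle group \<open>T\<^sub>u\<close> of these rotations (\<open>closure_contains_circle\<close>).
  Everything now depends on what \<open>G\<close> does to the line \<open>\<real>u\<close>.

  If some \<open>A \<in> G\<close> moves the line, then the closure also contains \<open>A T\<^sub>u A\<inverse> = T\<^sub>A\<^sub>u\<close>, and two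
  circle groups with different axes generate \<open>SO(3)\<close> (\<open>two_circles_generate_SO3\<close>), so \<open>G\<close> is
  dense.

  If \<open>G\<close> is commutative, then every \<open>A \<in> G\<close> commutes with \<open>T\<^sub>u\<close>, so \<open>T\<^sub>A\<^sub>u = T\<^sub>u\<close> with the same
  sense of rotation, that is, \<open>A u = u\<close> (\<open>commutative_fixes_axis\<close>). Hence
  \<open>G \<subseteq> T\<^sub>u \<subseteq> closure G\<close>, and \<open>T\<^sub>u\<close> is isomorphic and homeomorphic to \<open>SO(2)\<close>
  (\<open>circle_iso_SO2\<close>).

  If \<open>G\<close> preserves the line and is not commutative, then some generator \<open>A\<close> satisfies \<open>A u = -u\<close>
  because \<open>T\<^sub>u\<close> is commutative; after multiplication by \<open>A\<close> if necessary, the other generator \<open>B\<close>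
  fixes \<open>u\<close>. Such an \<open>A\<close> is a half-turn about an axis orthogonal to \<open>u\<close>, and \<open>B\<close> has infinite
  order, since otherwise \<open>G\<close> would be a finite dihedral group (\<open>dihedral_generators\<close>).\<close>

section \<open>Rotations about an axis\<close>

unbundle cross3_syntax

text \<open>Rodrigues' formula for the rotation by the angle \<open>t\<close> about the unit vector \<open>u\<close>.\<close>

definition rot :: "real^3 \<Rightarrow> real \<Rightarrow> real^3^3" where
  "rot u t = matrix (\<lambda>x. cos t *\<^sub>R x + sin t *\<^sub>R (u \<times> x) + ((1 - cos t) * (u \<bullet> x)) *\<^sub>R u)"

lemma rot_apply:
  "rot u t *v x = cos t *\<^sub>R x + sin t *\<^sub>R (u \<times> x) + ((1 - cos t) * (u \<bullet> x)) *\<^sub>R u"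
proof -
  have "linear (\<lambda>x. cos t *\<^sub>R x + sin t *\<^sub>R (u \<times> x) + ((1 - cos t) * (u \<bullet> x)) *\<^sub>R u)"
    by (intro linearI) (simp_all add: cross_add_right cross_mult_right inner_add_right algebra_simps)
  then show ?thesis
    unfolding rot_def by (simp add: matrix_works)
qed

lemma matrix_eqI: "(\<And>x. A *v x = B *v x) \<Longrightarrow> A = (B :: real^'n^'m)"
  by (simp add: matrix_eq)

text \<open>On the plane orthogonal to \<open>u\<close>, the map \<open>x \<mapsto> u \<times> x\<close> is a quarter turn, whose square
  is \<open>-1\<close>. This is what makes Rodrigues' formula additive in the angle.\<close>

lemma double_cross: "norm u = 1 \<Longrightarrow> u \<times> (u \<times> x) = (u \<bullet> x) *\<^sub>R u - x"
  by (simp add: Lagrange dot_square_norm)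

lemma rot_mult:
  assumes "norm u = 1" shows "rot u s ** rot u t = rot u (s + t)"
proof (rule matrix_eqI)
  fix x
  have "u \<bullet> u = 1" using assms by (simp add: dot_square_norm)
  then show "(rot u s ** rot u t) *v x = rot u (s + t) *v x"
    by (simp add: matrix_vector_mul_assoc[symmetric] rot_apply cross_add_right cross_mult_right
        inner_add_right dot_cross_self double_cross[OF assms] cos_add sin_add algebra_simps)
qed

lemma rot_0 [simp]: "rot u 0 = mat 1"
  by (rule matrix_eqI) (simp add: rot_apply)

lemma rot_neg: "rot (- u) t = rot u (- t)"
  by (rule matrix_eqI) (simp add: rot_apply)

lemma rot_periodic: "rot u (t + 2 * pi) = rot u t"
  by (simp add: rot_def)

lemma transpose_rot: "transpose (rot u t) = rot u (- t)"
proof -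
  have "x \<bullet> (rot u t *v y) = (rot u (- t) *v x) \<bullet> y" for x y
    using cross_triple[of u x y] cross_triple[of u y x] cross_skew[of x y]
    by (simp add: rot_apply inner_add_left inner_add_right inner_commute algebra_simps)
  then have "x \<bullet> (transpose (rot u t) *v y) = x \<bullet> (rot u (- t) *v y)" for x y
    by (metis dot_lmul_matrix inner_commute vector_transpose_matrix transpose_transpose)
  then show ?thesis
    by (metis matrix_eqI vector_eq_rdot inner_commute)
qed

abbreviation "SO3 \<equiv> (SO :: (real^3^3) monoid)"

lemma SO_simps [simp]:
  "A \<otimes>\<^bsub>SO\<^esub> B = A ** B" "\<one>\<^bsub>SO\<^esub> = mat 1" "A \<in> carrier SO \<longleftrightarrow> rotation_matrix A"
  by (simp_all add: SO_def)

lemma rotation_matrix_transpose_mult: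
  "rotation_matrix A \<Longrightarrow> transpose A ** A = mat 1" "rotation_matrix A \<Longrightarrow> A ** transpose A = mat 1"
  by (auto simp: rotation_matrix_def orthogonal_matrix_def)

lemma rotation_matrix_closed:
  fixes A B :: "real^'n^'n"
  shows "rotation_matrix (mat 1 :: real^'n^'n)"
    "rotation_matrix A \<Longrightarrow> rotation_matrix (transpose A)"
    "rotation_matrix A \<Longrightarrow> rotation_matrix B \<Longrightarrow> rotation_matrix (A ** B)"
  by (simp_all add: rotation_matrix_def orthogonal_matrix_mul orthogonal_matrix_id det_mul det_transpose)

lemma inv_SO: "rotation_matrix A \<Longrightarrow> inv\<^bsub>SO\<^esub> A = transpose A"
  by (rule group.inv_equality[OF group_SO])
    (auto simp: rotation_matrix_closed rotation_matrix_transpose_mult)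

lemma rotation_matrix_inner:
  fixes A :: "real^'n^'n"
  assumes "rotation_matrix A" shows "(A *v x) \<bullet> (A *v y) = x \<bullet> y"
  using assms
  by (metis dot_matrix_vector_mul dot_lmul_matrix matrix_vector_mul_assoc matrix_vector_mul_lid
      rotation_matrix_transpose_mult(1) vector_transpose_matrix transpose_transpose)

lemma rotation_matrix_norm:
  fixes A :: "real^'n^'n"
  shows "rotation_matrix A \<Longrightarrow> norm (A *v x) = norm x"
  by (simp add: norm_eq_sqrt_inner rotation_matrix_inner)

text \<open>The determinant of an orthogonal matrix is \<open>\<plusminus>1\<close>, and that of a rotation by \<open>t\<close> is the square of
  the determinant of the rotation by \<open>t / 2\<close>.\<close>

lemma rotation_matrix_rot:
  assumes "norm u = 1" shows "rotation_matrix (rot u t)"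
proof -
  have orth: "orthogonal_matrix (rot u t)" for t
    by (simp add: orthogonal_matrix transpose_rot rot_mult assms)
  have "det (rot u t) = det (rot u (t / 2)) * det (rot u (t / 2))"
    by (simp add: rot_mult assms flip: det_mul)
  then show ?thesis
    using orth[of t] det_orthogonal_matrix[OF orth[of "t / 2"]]
    by (auto simp: rotation_matrix_def)
qed

text \<open>Rodrigues' formula only involves the inner and the cross product, and both are preserved by
  \<open>A\<close>.\<close>

lemma rot_conj:
  assumes "rotation_matrix A"
  shows "A ** rot u t ** transpose A = rot (A *v u) t"
proof (rule matrix_eqI)
  fix x
  define y where "y = transpose A *v x"
  have x: "x = A *v y"
    by (simp add: y_def matrix_vector_mul_assoc rotation_matrix_transpose_mult assms
        del: transpose_matrix_vector)
  have "(A ** rot u t ** transpose A) *v x = A *v (rot u t *v y)"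
    by (simp add: y_def matrix_vector_mul_assoc matrix_mul_assoc del: transpose_matrix_vector)
  also have "\<dots> = rot (A *v u) t *v (A *v y)"
    by (simp add: rot_apply matrix_vector_right_distrib cross_rotation_matrix[OF assms]
        rotation_matrix_inner[OF assms] matrix_vector_mult_scaleR)
  finally show "(A ** rot u t ** transpose A) *v x = rot (A *v u) t *v x"
    by (simp add: x)
qed

lemma rot_fixes: "norm u = 1 \<Longrightarrow> rot u t *v u = u"
  by (simp add: rot_apply dot_square_norm algebra_simps)

lemma sphere_orthogonal_exists:
  obtains e :: "real^3" where "norm e = 1" "u \<bullet> e = 0"
proof -
  obtain x :: "real^3" where "x \<noteq> 0" "orthogonal u x"
    using orthogonal_to_vector_exists[of u] by auto
  then show ?thesis
    using that[of "x /\<^sub>R norm x"] by (simp add: orthogonal_def)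
qed

lemma cross_orthonormal:
  assumes "norm u = 1" and "norm e = 1" and "u \<bullet> e = 0"
  shows "norm (u \<times> e) = 1" "e \<bullet> (u \<times> e) = 0" "u \<bullet> (u \<times> e) = 0"
  using assms norm_cross_dot[of u e] by (auto simp: dot_cross_self power2_eq_1_iff)
    (metis norm_ge_zero neg_0_le_iff_le not_one_le_zero)

text \<open>The difference \<open>y\<close> of the two sides is orthogonal to \<open>u\<close>, \<open>e\<close> and \<open>f = u \<times> e\<close>. Then
  \<open>y \<times> f = y \<times> (u \<times> e) = 0\<close>, so \<open>y\<close> is both parallel and orthogonal to \<open>f \<noteq> 0\<close>.\<close>

lemma orthonormal_expansion:
  assumes "norm u = 1" and "norm e = 1" and "u \<bullet> e = 0"
  shows "x = (u \<bullet> x) *\<^sub>R u + (e \<bullet> x) *\<^sub>R e + ((u \<times> e) \<bullet> x) *\<^sub>R (u \<times> e)"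
proof -
  define f where "f = u \<times> e"
  note ff = cross_orthonormal[OF assms, folded f_def]
  define y where "y = x - ((u \<bullet> x) *\<^sub>R u + (e \<bullet> x) *\<^sub>R e + (f \<bullet> x) *\<^sub>R f)"
  have y: "u \<bullet> y = 0" "e \<bullet> y = 0" "f \<bullet> y = 0"
    using assms ff
    by (simp_all add: y_def inner_diff_right inner_add_right dot_square_norm inner_commute)
  then have "y \<times> f = 0"
    by (simp add: f_def Lagrange inner_commute)
  then have "y = 0"
    using norm_and_cross_eq_0[of y f] y ff by (auto simp: inner_commute)
  then show ?thesis
    by (simp add: y_def f_def)
qed

text \<open>In the orthonormal frame \<open>(u, e, u \<times> e)\<close> the map \<open>A\<close> is determined by
  \<open>A e = cos t e + sin t (u \<times> e)\<close>, since it preserves the cross product.\<close>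

lemma rotation_with_fixed_vector_is_rot:
  assumes "rotation_matrix A" and "norm u = 1" and "A *v u = u"
  obtains t where "0 \<le> t" "t < 2 * pi" "A = rot u t"
proof -
  obtain e where e: "norm e = 1" "u \<bullet> e = 0"
    using sphere_orthogonal_exists by blast
  define f where "f = u \<times> e"
  note ff = cross_orthonormal[OF assms(2) e, folded f_def]
  note expand = orthonormal_expansion[OF assms(2) e, folded f_def]
  have "u \<bullet> (A *v e) = 0"
    using rotation_matrix_inner[OF assms(1), of u e] assms(3) e by simp
  then have Ae: "A *v e = (e \<bullet> (A *v e)) *\<^sub>R e + (f \<bullet> (A *v e)) *\<^sub>R f"
    using expand[of "A *v e"] by simp
  have "(e \<bullet> (A *v e))\<^sup>2 + (f \<bullet> (A *v e))\<^sup>2 = (A *v e) \<bullet> (A *v e)"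
    by (subst (3 4) Ae) (use e ff in \<open>simp add: inner_add_left inner_add_right inner_commute dot_square_norm power2_eq_square\<close>)
  also have "\<dots> = 1"
    by (simp add: rotation_matrix_norm assms(1) dot_square_norm e)
  finally obtain t where t: "0 \<le> t" "t < 2 * pi" "e \<bullet> (A *v e) = cos t" "f \<bullet> (A *v e) = sin t"
    using sincos_total_2pi by metis
  have Ae: "A *v e = cos t *\<^sub>R e + sin t *\<^sub>R f"
    using Ae t by simp
  have uf: "u \<times> f = - e"
    using double_cross[OF assms(2), of e] e by (simp add: f_def)
  have Af: "A *v f = cos t *\<^sub>R f - sin t *\<^sub>R e"
    using cross_rotation_matrix[OF assms(1), of u e, symmetric]
    by (simp add: Ae assms(3) cross_add_right cross_mult_right uf flip: f_def)
  have "A = rot u t"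
  proof (rule matrix_eqI)
    fix x
    have "A *v x = A *v ((u \<bullet> x) *\<^sub>R u + (e \<bullet> x) *\<^sub>R e + (f \<bullet> x) *\<^sub>R f)"
      using expand[of x] by simp
    also have "\<dots> = rot u t *v ((u \<bullet> x) *\<^sub>R u + (e \<bullet> x) *\<^sub>R e + (f \<bullet> x) *\<^sub>R f)"
      by (simp add: matrix_vector_right_distrib matrix_vector_mult_scaleR Ae Af assms(3)
          rot_fixes[OF assms(2)])
         (simp add: rot_apply e ff uf flip: f_def)
    also have "\<dots> = rot u t *v x"
      using expand[of x] by simp
    finally show "A *v x = rot u t *v x" .
  qed
  then show ?thesis
    using that t by blast
qed

text \<open>Euler's theorem. From \<open>A\<^sup>T (A - 1) = 1 - A\<^sup>T = -(A - 1)\<^sup>T\<close> and the odd dimension it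
  follows that \<open>det (A - 1) = - det (A - 1)\<close>, so \<open>A - 1\<close> has a kernel.\<close>

lemma rotation_fixes_unit_vector:
  fixes A :: "real^3^3"
  assumes "rotation_matrix A"
  obtains u where "norm u = 1" "A *v u = u"
proof -
  have "transpose A ** (A - mat 1) = mat 1 - transpose A"
    by (rule matrix_eqI)
      (simp add: matrix_vector_mul_assoc[symmetric] matrix_vector_mult_diff_rdistrib
        matrix_vector_mult_diff_distrib del: transpose_matrix_vector,
       simp add: matrix_vector_mul_assoc rotation_matrix_transpose_mult assms
        del: transpose_matrix_vector)
  then have "det (A - mat 1) = det (mat 1 - transpose A)"
    using assms by (metis det_mul det_transpose mult_1 rotation_matrix_def)
  also have "\<dots> = - det (A - mat 1)"
    by (simp add: det_3 transpose_def mat_def algebra_simps)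
  finally have "det (A - mat 1) = 0" by simp
  then obtain x where x: "(A - mat 1) *v x = 0" "x \<noteq> 0"
    using invertible_det_nz[of "A - mat 1"] matrix_left_invertible_ker[of "A - mat 1"]
    by (auto simp: invertible_left_inverse)
  show ?thesis
    using that[of "x /\<^sub>R norm x"] x
    by (simp add: matrix_vector_mult_scaleR matrix_vector_mult_diff_rdistrib)
qed

section \<open>Topology of the rotation group\<close>

lemma bounded_bilinear_cross: "bounded_bilinear (\<times>)"
  using bilinear_cross by (simp add: bilinear_conv_bounded_bilinear)

lemma tendsto_rot [tendsto_intros]:
  assumes "(f \<longlongrightarrow> u) F" and "(g \<longlongrightarrow> t) F"
  shows "((\<lambda>x. rot (f x) (g x)) \<longlongrightarrow> rot u t) F"
  unfolding rot_def matrix_def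
  by (intro vec_tendstoI)
    (auto intro!: tendsto_intros assms isCont_tendsto_compose[OF isCont_cos]
        isCont_tendsto_compose[OF isCont_sin]
        bounded_bilinear.tendsto[OF bounded_bilinear_cross])

lemma continuous_on_rot:
  "continuous_on S f \<Longrightarrow> continuous_on S g \<Longrightarrow> continuous_on S (\<lambda>x. rot (f x) (g x))"
  by (simp add: continuous_on_def tendsto_rot)

lemma tendsto_matrix_mult [tendsto_intros]:
  fixes A B :: "real^'n^'n"
  assumes "(f \<longlongrightarrow> A) F" and "(g \<longlongrightarrow> B) F"
  shows "((\<lambda>x. f x ** g x) \<longlongrightarrow> A ** B) F"
  unfolding matrix_matrix_mult_def
  by (intro vec_tendstoI) (auto intro!: tendsto_intros assms)

lemma tendsto_transpose [tendsto_intros]: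
  fixes A :: "real^'n^'n"
  assumes "(f \<longlongrightarrow> A) F"
  shows "((\<lambda>x. transpose (f x)) \<longlongrightarrow> transpose A) F"
  unfolding transpose_def
  by (intro vec_tendstoI) (auto intro!: tendsto_intros assms)

text \<open>Replacing \<open>u\<close> by \<open>-u\<close> reverses the angle, so angles between \<open>0\<close> and \<open>\<pi>\<close> suffice. With
  this choice rotations close to \<open>1\<close> have angles close to \<open>0\<close>, and not close to \<open>2 \<pi>\<close>.\<close>

lemma rotation_is_rot:
  assumes "rotation_matrix A"
  obtains u t where "norm u = 1" "0 \<le> t" "t \<le> pi" "A = rot u t"
proof -
  obtain u where u: "norm u = 1" "A *v u = u"
    using rotation_fixes_unit_vector[OF assms] .
  obtain t where t: "0 \<le> t" "t < 2 * pi" "A = rot u t"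
    using rotation_with_fixed_vector_is_rot[OF assms u] .
  show ?thesis
  proof (cases "t \<le> pi")
    case True
    then show ?thesis using that u t by blast
  next
    case False
    have "A = rot (- u) (2 * pi - t)"
      using rot_periodic[of u "t - 2 * pi"] by (simp add: t rot_neg)
    then show ?thesis
      using that[of "- u" "2 * pi - t"] u t False by simp
  qed
qed

text \<open>Axis and angle exhibit \<open>SO(3)\<close> as a continuous image of a sphere times an interval.\<close>

lemma compact_SO3: "compact (carrier SO3)"
proof -
  let ?P = "SIGMA u:sphere (0::real^3) 1. {0..pi}"
  have "carrier SO3 \<subseteq> (\<lambda>p. rot (fst p) (snd p)) ` ?P"
  proof
    fix A assume "A \<in> carrier SO3"
    then have "rotation_matrix A" by simp
    then obtain u t where "norm u = 1" "0 \<le> t" "t \<le> pi" "A = rot u t"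
      by (rule rotation_is_rot)
    then show "A \<in> (\<lambda>p. rot (fst p) (snd p)) ` ?P"
      by (intro image_eqI[of _ _ "(u, t)"]) auto
  qed
  then have eq: "carrier SO3 = (\<lambda>p. rot (fst p) (snd p)) ` ?P"
    by (auto simp: rotation_matrix_rot)
  have "continuous_on ?P (\<lambda>p. rot (fst p) (snd p))"
    by (rule continuous_on_rot; rule continuous_intros; rule continuous_on_id)
  moreover have "compact ?P"
    by (intro compact_Times compact_sphere compact_Icc)
  ultimately show ?thesis
    unfolding eq by (rule compact_continuous_image)
qed

lemma rot_eq_mat_1_imp:
  assumes "norm u = 1" and "rot u t = mat 1"
  shows "cos t = 1"
proof -
  obtain e :: "real^3" where e: "norm e = 1" "u \<bullet> e = 0"
    using sphere_orthogonal_exists .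
  have "e \<bullet> (rot u t *v e) = 1"
    by (simp add: assms dot_square_norm e)
  then show ?thesis
    using e by (simp add: rot_apply inner_add_right dot_cross_self dot_square_norm inner_commute)
qed

lemma subgroup_SOD:
  assumes "subgroup G SO"
  shows "A \<in> G \<Longrightarrow> rotation_matrix A" "mat 1 \<in> G"
    "A \<in> G \<Longrightarrow> B \<in> G \<Longrightarrow> A ** B \<in> G" "A \<in> G \<Longrightarrow> transpose A \<in> G"
  using subgroup.mem_carrier[OF assms] subgroup.one_closed[OF assms]
    subgroup.m_closed[OF assms] subgroup.m_inv_closed[OF assms]
  by (auto simp: inv_SO)

lemma subgroup_SOI:
  assumes "\<And>A. A \<in> G \<Longrightarrow> rotation_matrix A" "mat 1 \<in> G"
    "\<And>A B. A \<in> G \<Longrightarrow> B \<in> G \<Longrightarrow> A ** B \<in> G" "\<And>A. A \<in> G \<Longrightarrow> transpose A \<in> G"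
  shows "subgroup G SO"
  using assms by (intro group.subgroupI[OF group_SO]) (auto simp: inv_SO)

lemma subgroup_closure:
  assumes "subgroup G SO3"
  shows "subgroup (closure G) SO"
proof (rule subgroup_SOI)
  fix A assume "A \<in> closure G"
  moreover have "closure G \<subseteq> carrier SO"
    using subgroup.subset[OF assms] compact_SO3 by (simp add: closure_minimal compact_imp_closed)
  ultimately show "rotation_matrix A"
    by auto
next
  show "mat 1 \<in> closure G"
    using closure_subset subgroup_SOD(2)[OF assms] by auto
next
  fix A B assume "A \<in> closure G" "B \<in> closure G"
  then obtain f g where "\<forall>n::nat. f n \<in> G" "f \<longlonglongrightarrow> A" "\<forall>n::nat. g n \<in> G" "g \<longlonglongrightarrow> B"
    by (auto simp: closure_sequential)
  then have "\<forall>n. f n ** g n \<in> G" "(\<lambda>n. f n ** g n) \<longlonglongrightarrow> A ** B"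
    by (auto intro!: tendsto_intros subgroup_SOD[OF assms])
  then show "A ** B \<in> closure G"
    by (force simp: closure_sequential)
next
  fix A assume "A \<in> closure G"
  then obtain f where "\<forall>n::nat. f n \<in> G" "f \<longlonglongrightarrow> A"
    by (auto simp: closure_sequential)
  then have "\<forall>n. transpose (f n) \<in> G" "(\<lambda>n. transpose (f n)) \<longlonglongrightarrow> transpose A"
    by (auto intro!: tendsto_intros subgroup_SOD[OF assms])
  then show "transpose A \<in> closure G"
    by (force simp: closure_sequential)
qed

text \<open>By compactness \<open>G\<close> accumulates at some rotation \<open>X\<close>, which need not be in \<open>G\<close>. If \<open>f\<^sub>n \<in> G\<close>
  converges to \<open>X\<close> and \<open>f\<^sub>k\<close> is a later element different from \<open>f\<^sub>n\<close>, then the quotient of the two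
  is in \<open>G\<close>, is not \<open>1\<close>, and is close to \<open>X\<^sup>T X = 1\<close>.\<close>

lemma infinite_subgroup_accumulates_at_1:
  assumes "subgroup G SO3" and "infinite G"
  obtains g where "\<And>n::nat. g n \<in> G" "\<And>n. g n \<noteq> mat 1" "g \<longlonglongrightarrow> mat 1"
proof -
  obtain X where X: "X \<in> carrier SO3" "X islimpt G"
    using compact_SO3 assms subgroup.subset[OF assms(1)]
    by (auto simp: compact_eq_Bolzano_Weierstrass)
  then obtain f where f: "\<And>n. f n \<in> G" "\<And>n. f n \<noteq> X" "f \<longlonglongrightarrow> X"
    by (auto simp: islimpt_sequential)
  have "\<exists>m. m \<ge> n \<and> f m \<noteq> f n" for n
  proof -
    have "\<forall>\<^sub>F m in sequentially. f m \<noteq> f n"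
      by (rule tendsto_imp_eventually_ne[OF f(3)]) (use f(2) in metis)
    then have "\<forall>\<^sub>F m in sequentially. m \<ge> n \<and> f m \<noteq> f n"
      using eventually_ge_at_top eventually_conj by blast
    then show ?thesis
      by (auto simp: eventually_sequentially)
  qed
  then obtain k where k: "\<And>n. k n \<ge> n" "\<And>n. f (k n) \<noteq> f n"
    by metis
  have "filterlim k at_top sequentially"
    using filterlim_at_top_mono[OF filterlim_ident, of k] k(1) by simp
  then have "(\<lambda>n. f (k n)) \<longlonglongrightarrow> X"
    using f(3) filterlim_compose by blast
  then have "(\<lambda>n. transpose (f n) ** f (k n)) \<longlonglongrightarrow> transpose X ** X"
    by (intro tendsto_intros f)
  moreover have "transpose (f n) ** f (k n) \<noteq> mat 1" for n
    using k(2)[of n] rotation_matrix_transpose_mult(2)[OF subgroup_SOD(1)[OF assms(1) f(1)[of n]]]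
    by (metis matrix_mul_assoc matrix_mul_lid matrix_mul_rid)
  moreover have "transpose (f n) ** f (k n) \<in> G" for n
    by (intro subgroup_SOD[OF assms(1)] f)
  ultimately show ?thesis
    using that[of "\<lambda>n. transpose (f n) ** f (k n)"] X rotation_matrix_transpose_mult(1)[of X]
    by auto
qed

lemma subgroup_rot_multiple:
  assumes "subgroup G SO3" "norm u = 1" "rot u t \<in> G"
  shows "rot u (of_nat n * t) \<in> G"
proof (induction n)
  case 0
  then show ?case by (simp add: subgroup_SOD[OF assms(1)])
next
  case (Suc n)
  then show ?case
    using subgroup_SOD(3)[OF assms(1) assms(3) Suc]
    by (simp add: rot_mult assms(2) algebra_simps)
qed

lemma rot_nonneg_angle:
  obtains t' where "0 \<le> t'" "rot u t' = rot u t"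
proof -
  have *: "rot u (t + 2 * pi * real k) = rot u t" for k
  proof (induction k)
    case (Suc k)
    then show ?case
      using rot_periodic[of u "t + 2 * pi * real k"] by (simp add: algebra_simps)
  qed simp
  obtain k where "- t < real k * (2 * pi)"
    using reals_Archimedean3[of "2 * pi"] by auto
  then show ?thesis
    using that[of "t + 2 * pi * real k"] * by (simp add: algebra_simps)
qed

text \<open>Let \<open>g\<^sub>n \<in> G\<close> be the rotation by \<open>\<theta>\<^sub>n > 0\<close> about \<open>v\<^sub>n\<close>, with \<open>\<theta>\<^sub>n \<longlonglongrightarrow> 0\<close> and
  \<open>v\<^sub>n \<longlonglongrightarrow> u\<close>. The power of \<open>g\<^sub>n\<close> with exponent \<open>\<lfloor>t / \<theta>\<^sub>n\<rfloor>\<close> is a rotation about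
  \<open>v\<^sub>n\<close> whose angle differs from \<open>t\<close> by at most \<open>\<theta>\<^sub>n\<close>, so these powers converge to the rotation
  by \<open>t\<close> about \<open>u\<close>.\<close>

lemma closure_contains_circle:
  assumes "subgroup G SO3" and "infinite G"
  obtains u where "norm u = 1" "\<And>t. rot u t \<in> closure G"
proof -
  obtain g where g: "\<And>n::nat. g n \<in> G" "\<And>n. g n \<noteq> mat 1" "g \<longlonglongrightarrow> mat 1"
    using infinite_subgroup_accumulates_at_1[OF assms] by blast
  have "\<exists>p. norm (fst p) = 1 \<and> 0 \<le> snd p \<and> snd p \<le> pi \<and> g n = rot (fst p) (snd p)" for n
    using rotation_is_rot[OF subgroup_SOD(1)[OF assms(1) g(1)[of n]]]
    by (metis fst_conv snd_conv)
  then obtain p where p: "\<And>n. norm (fst (p n)) = 1" "\<And>n. 0 \<le> snd (p n)" "\<And>n. snd (p n) \<le> pi"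
      "\<And>n. g n = rot (fst (p n)) (snd (p n))"
    by metis
  have "compact (SIGMA u:sphere (0::real^3) 1. {0..pi})"
    by (intro compact_Times compact_sphere compact_Icc)
  moreover have "\<forall>n. p n \<in> (SIGMA u:sphere 0 1. {0..pi})"
    using p by (auto simp: mem_Times_iff)
  ultimately obtain q r where q: "q \<in> (SIGMA u:sphere (0::real^3) 1. {0..pi})" "strict_mono r"
      "(p \<circ> r) \<longlonglongrightarrow> q"
    unfolding compact_def by meson
  define u where "u = fst q"
  define v where "v n = fst (p (r n))" for n
  define \<theta> where "\<theta> n = snd (p (r n))" for n
  have lim: "v \<longlonglongrightarrow> u" "\<theta> \<longlonglongrightarrow> snd q"
    unfolding v_def \<theta>_def u_def using q(3) by (auto simp: o_def intro!: tendsto_intros)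
  have u: "norm u = 1"
    using q(1) by (auto simp: u_def mem_Times_iff)
  have "(\<lambda>n. g (r n)) \<longlonglongrightarrow> mat 1"
    using LIMSEQ_subseq_LIMSEQ[OF g(3) q(2)] by (simp add: o_def)
  moreover have "(\<lambda>n. g (r n)) \<longlonglongrightarrow> rot u (snd q)"
    unfolding p(4) by (intro tendsto_intros lim[unfolded v_def \<theta>_def])
  ultimately have "cos (snd q) = 1"
    using rot_eq_mat_1_imp[OF u] LIMSEQ_unique by metis
  then have "snd q = 0"
    using q(1) by (metis arccos_1 arccos_cos mem_Times_iff atLeastAtMost_iff)
  with lim have \<theta>0: "\<theta> \<longlonglongrightarrow> 0" by simp
  have \<theta>pos: "\<theta> n > 0" for n
    using g(2)[of "r n"] p(2)[of "r n"] p(4)[of "r n"] by (auto simp: \<theta>_def less_le)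
  have *: "rot u t \<in> closure G" if "t \<ge> 0" for t
  proof -
    define k where "k n = nat \<lfloor>t / \<theta> n\<rfloor>" for n
    have k: "real (k n) * \<theta> n \<le> t" "t \<le> real (k n) * \<theta> n + \<theta> n" for n
    proof -
      have "real (k n) = of_int \<lfloor>t / \<theta> n\<rfloor>"
        using that \<theta>pos[of n] by (simp add: k_def)
      then have "real (k n) \<le> t / \<theta> n" "t / \<theta> n \<le> real (k n) + 1"
        by linarith+
      then show "real (k n) * \<theta> n \<le> t" "t \<le> real (k n) * \<theta> n + \<theta> n"
        using \<theta>pos[of n] by (simp_all add: field_simps)
    qed
    have "(\<lambda>n. real (k n) * \<theta> n) \<longlonglongrightarrow> t"
    proof (rule tendsto_sandwich)
      show "\<forall>\<^sub>F n in sequentially. t - \<theta> n \<le> real (k n) * \<theta> n"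
        using k(2) by (simp add: algebra_simps)
      show "(\<lambda>n. t - \<theta> n) \<longlonglongrightarrow> t"
        using tendsto_diff[OF tendsto_const \<theta>0, of t] by simp
    qed (use k in auto)
    then have "(\<lambda>n. rot (v n) (real (k n) * \<theta> n)) \<longlonglongrightarrow> rot u t"
      by (intro tendsto_intros lim)
    moreover have "rot (v n) (real (k n) * \<theta> n) \<in> G" for n
      using subgroup_rot_multiple[OF assms(1), of "v n" "\<theta> n" "k n"] p g
      by (metis v_def \<theta>_def)
    ultimately show ?thesis
      by (force simp: closure_sequential)
  qed
  then have "rot u t \<in> closure G" for t
    using rot_nonneg_angle[of u t] by metis
  then show ?thesis
    using that u by blast
qed

text \<open>The components of \<open>x\<close> and \<open>y\<close> orthogonal to \<open>u\<close> have the same length, so they lie on one circle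
  around \<open>0\<close> in the plane that \<open>T\<^sub>u\<close> rotates.\<close>

lemma rot_transitive_on_circles:
  assumes "norm u = 1" and "norm x = norm y" and "u \<bullet> x = u \<bullet> y"
  obtains t where "rot u t *v x = y"
proof -
  define x' where "x' = x - (u \<bullet> x) *\<^sub>R u"
  define y' where "y' = y - (u \<bullet> x) *\<^sub>R u"
  have uu: "u \<bullet> u = 1"
    using assms(1) by (simp add: dot_square_norm)
  have perp: "u \<bullet> x' = 0" "u \<bullet> y' = 0"
    using assms(3) uu by (simp_all add: x'_def y'_def inner_diff_right)
  have "x \<bullet> x = y \<bullet> y"
    using assms(2) by (simp add: dot_square_norm)
  then have "x' \<bullet> x' = y' \<bullet> y'"
    using assms(3) uu
    by (simp add: x'_def y'_def inner_diff_right inner_diff_left inner_commute)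
  then have norm_eq: "norm y' = norm x'"
    by (simp add: norm_eq)
  have rot_x: "rot u t *v x = rot u t *v x' + (u \<bullet> x) *\<^sub>R u" for t
    by (simp add: x'_def matrix_vector_mult_diff_distrib matrix_vector_mult_scaleR
        rot_fixes[OF assms(1)])
  show ?thesis
  proof (cases "x' = 0")
    case True
    then show ?thesis
      using that[of 0] norm_eq by (simp add: x'_def y'_def)
  next
    case False
    define r where "r = norm x'"
    define e where "e = x' /\<^sub>R r"
    have r: "r > 0" using False by (simp add: r_def)
    have e: "norm e = 1" "u \<bullet> e = 0"
      using r perp by (simp_all add: e_def r_def)
    have x'_eq: "x' = r *\<^sub>R e"
      using r by (simp add: e_def)
    define f where "f = u \<times> e"
    note ff = cross_orthonormal[OF assms(1) e, folded f_def]
    have y'_eq: "y' = (e \<bullet> y') *\<^sub>R e + (f \<bullet> y') *\<^sub>R f"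
      using orthonormal_expansion[OF assms(1) e, folded f_def, of y'] perp by simp
    have "(e \<bullet> y')\<^sup>2 + (f \<bullet> y')\<^sup>2 = y' \<bullet> y'"
      by (subst (3 4) y'_eq) (use e ff in \<open>simp add: inner_add_left inner_add_right
            inner_commute dot_square_norm power2_eq_square\<close>)
    also have "\<dots> = r\<^sup>2"
      by (simp add: dot_square_norm norm_eq r_def)
    finally have "(e \<bullet> y' / r)\<^sup>2 + (f \<bullet> y' / r)\<^sup>2 = 1"
      using r by (simp add: power_divide flip: add_divide_distrib)
    then obtain t where "e \<bullet> y' / r = cos t" "f \<bullet> y' / r = sin t"
      using sincos_total_2pi by metis
    then have "y' = r *\<^sub>R (cos t *\<^sub>R e + sin t *\<^sub>R f)"
      using y'_eq r by (simp add: field_simps scaleR_add_right)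
    also have "\<dots> = rot u t *v x'"
      by (simp add: x'_eq matrix_vector_mult_scaleR rot_apply e f_def)
    finally show ?thesis
      using that[of t] rot_x[of t] by (metis y'_def diff_add_cancel)
  qed
qed

text \<open>The set \<open>W\<close> of the unit vectors whose circle group lies in \<open>K\<close> is compact and
  \<open>K\<close>-invariant, and the claim is that it is the whole sphere. Call \<open>u \<bullet> x\<close> the height of \<open>x\<close>. As
  \<open>T\<^sub>u\<close> is transitive on the points of a given height, \<open>W\<close> is determined by the heights of its
  points. If \<open>w \<in> W\<close> has height \<open>c\<close> with \<open>\<bar>c\<bar> < 1\<close>, then turning \<open>u\<close> about \<open>w\<close> yields points of
  \<open>W\<close> of all heights between \<open>2 c\<^sup>2 - 1\<close> and \<open>1\<close>. Let \<open>w\<close> minimize \<open>\<bar>c\<bar>\<close>. Since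
  \<open>2 c\<^sup>2 - 1 < \<bar>c\<bar>\<close>, a minimum \<open>\<bar>c\<bar> > 0\<close> could be improved. Hence \<open>c = 0\<close>, and all heights
  occur.\<close>

lemma two_circles_generate_SO3:
  assumes "subgroup K SO3" and "closed K"
    and u: "norm u = 1" "\<And>t. rot u t \<in> K" and v: "norm v = 1" "\<And>t. rot v t \<in> K"
    and "v \<noteq> u" "v \<noteq> - u"
  shows "carrier SO \<subseteq> K"
proof -
  define W where "W = {w. norm w = 1 \<and> (\<forall>t. rot w t \<in> K)}"
  have inv: "A *v w \<in> W" if "A \<in> K" "w \<in> W" for A w
  proof -
    have "rot (A *v w) t \<in> K" for t
      using that subgroup_SOD[OF assms(1)] by (simp add: W_def flip: rot_conj)
    then show ?thesis
      using that subgroup_SOD(1)[OF assms(1)] by (simp add: W_def rotation_matrix_norm)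
  qed
  have "closed W"
    unfolding closed_sequential_limits
  proof (intro allI impI, elim conjE)
    fix f :: "nat \<Rightarrow> real^3" and l
    assume f: "\<forall>n. f n \<in> W" "f \<longlonglongrightarrow> l"
    have "rot l t \<in> K" for t
    proof (rule closed_sequentially[OF assms(2)])
      show "rot (f n) t \<in> K" for n
        using f by (auto simp: W_def)
      show "(\<lambda>n. rot (f n) t) \<longlonglongrightarrow> rot l t"
        by (intro tendsto_intros f)
    qed
    moreover have "norm l = 1"
      using tendsto_norm[OF f(2)] f(1) by (simp add: W_def LIMSEQ_const_iff)
    ultimately show "l \<in> W" by (simp add: W_def)
  qed
  moreover have "bounded W"
    by (auto simp: W_def bounded_iff)
  ultimately have "compact W"
    by (simp add: compact_eq_bounded_closed)
  have vW: "v \<in> W" and uW: "u \<in> W"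
    using u v by (auto simp: W_def)
  have "continuous_on W (\<lambda>w. \<bar>u \<bullet> w\<bar>)"
    by (intro continuous_intros)
  then obtain w where w: "w \<in> W" "\<And>x. x \<in> W \<Longrightarrow> \<bar>u \<bullet> w\<bar> \<le> \<bar>u \<bullet> x\<bar>"
    using continuous_attains_inf[OF \<open>compact W\<close>, of "\<lambda>w. \<bar>u \<bullet> w\<bar>"] vW by blast
  define c where "c = u \<bullet> w"
  have uu: "u \<bullet> u = 1" using u by (simp add: dot_square_norm)
  have "\<bar>u \<bullet> v\<bar> < 1"
  proof (rule ccontr)
    assume "\<not> ?thesis"
    then have "\<bar>u \<bullet> v\<bar> = norm u * norm v"
      using Cauchy_Schwarz_ineq2[of u v] u v by simp
    then show False
      using assms norm_cauchy_schwarz_abs_eq[of u v] by auto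
  qed
  with w(2)[OF vW] have c1: "\<bar>c\<bar> < 1" by (simp add: c_def)
  then have c2: "c\<^sup>2 < 1" by (simp add: abs_square_less_1)
  have height: "\<exists>x\<in>W. u \<bullet> x = s" if "2 * c\<^sup>2 - 1 \<le> s" "s \<le> 1" for s
  proof -
    \<comment> \<open>Turning \<open>u\<close> about \<open>w\<close> by \<open>t\<close> leads to the height \<open>cos t + (1 - cos t) c\<^sup>2\<close>; solve for \<open>cos t\<close>.\<close>
    define a where "a = (s - c\<^sup>2) / (1 - c\<^sup>2)"
    have "-1 \<le> a" "a \<le> 1"
      using that c2 by (simp_all add: a_def field_simps)
    then have a: "cos (arccos a) = a" by simp
    have "u \<bullet> (rot w (arccos a) *v u) = a + (1 - a) * c\<^sup>2"
      using \<open>-1 \<le> a\<close> \<open>a \<le> 1\<close> uu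
      by (simp add: rot_apply inner_add_right dot_cross_self c_def inner_commute power2_eq_square)
    also have "\<dots> = s"
      using c2 by (simp add: a_def divide_simps) (simp add: algebra_simps)
    finally show ?thesis
      using inv[of "rot w (arccos a)" u] w(1) uW by (auto simp: W_def)
  qed
  have "c = 0"
  proof (rule ccontr)
    assume "c \<noteq> 0"
    have "2 * \<bar>c\<bar>\<^sup>2 - 1 - \<bar>c\<bar> = (2 * \<bar>c\<bar> + 1) * (\<bar>c\<bar> - 1)"
      by (simp add: algebra_simps power2_eq_square)
    also have "\<dots> < 0"
      using c1 by (intro mult_pos_neg) auto
    finally have "2 * c\<^sup>2 - 1 < \<bar>c\<bar>" by simp
    \<comment> \<open>Where \<open>2 c\<^sup>2 - 1\<close> is negative, its absolute value may exceed \<open>\<bar>c\<bar>\<close>, but then the height \<open>0\<close> occurs.\<close>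
    obtain x where "x \<in> W" "u \<bullet> x = max 0 (2 * c\<^sup>2 - 1)"
      using height[of "max 0 (2 * c\<^sup>2 - 1)"] c2 by auto
    then show False
      using w(2)[of x] \<open>c \<noteq> 0\<close> \<open>2 * c\<^sup>2 - 1 < \<bar>c\<bar>\<close> by (auto simp: c_def max_def split: if_splits)
  qed
  have "x \<in> W" if x: "norm x = 1" for x
  proof -
    have "\<bar>u \<bullet> x\<bar> \<le> 1"
      using Cauchy_Schwarz_ineq2[of u x] x u by simp
    then have "2 * c\<^sup>2 - 1 \<le> u \<bullet> x" "u \<bullet> x \<le> 1"
      using \<open>c = 0\<close> by simp_all
    then obtain y where y: "y \<in> W" "u \<bullet> y = u \<bullet> x"
      using height by blast
    then obtain t where "rot u t *v y = x"
      using rot_transitive_on_circles[OF u(1), of y x] x by (auto simp: W_def)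
    then show ?thesis
      using inv[OF u(2) y(1)] by metis
  qed
  then show ?thesis
    using rotation_is_rot by (auto simp: W_def) metis
qed

section \<open>Circle subgroups\<close>

lemma subgroup_generate_SO:
  assumes "S \<subseteq> carrier SO" shows "subgroup (generate SO S) SO"
  using group.generate_is_subgroup[OF group_SO] assms by blast

lemma comm_group_subgroup_SO_iff:
  assumes "subgroup G SO"
  shows "comm_group (SO\<lparr>carrier := G\<rparr>) \<longleftrightarrow> (\<forall>A\<in>G. \<forall>B\<in>G. A ** B = B ** A)"
proof
  assume "comm_group (SO\<lparr>carrier := G\<rparr>)"
  then interpret comm_group "SO\<lparr>carrier := G\<rparr>" .
  show "\<forall>A\<in>G. \<forall>B\<in>G. A ** B = B ** A"
    using m_comm by simp
next
  assume "\<forall>A\<in>G. \<forall>B\<in>G. A ** B = B ** A"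
  then show "comm_group (SO\<lparr>carrier := G\<rparr>)"
    using group.group_comm_groupI[OF subgroup.subgroup_is_group[OF assms group_SO]] by simp
qed

lemma circle_eq_stabilizer:
  assumes "norm u = 1"
  shows "range (rot u) = {A. rotation_matrix A \<and> A *v u = u}"
  using assms
  by (auto simp: rotation_matrix_rot rot_fixes elim!: rotation_with_fixed_vector_is_rot)

lemma subgroup_circle:
  assumes "norm u = 1" shows "subgroup (range (rot u)) SO"
proof (rule subgroup_SOI)
  show "mat 1 \<in> range (rot u)" using rot_0 by (metis rangeI)
qed (use assms in \<open>auto simp: rotation_matrix_rot rot_mult transpose_rot\<close>)

lemma compact_circle:
  assumes "norm u = 1" shows "compact (range (rot u))"
proof -
  have "rot u t \<in> rot u ` {0..2 * pi}" for t
    using rotation_with_fixed_vector_is_rot[OF rotation_matrix_rot[OF assms] assms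
        rot_fixes[OF assms], of t]
    by (metis atLeastAtMost_iff image_eqI less_imp_le)
  then have eq: "range (rot u) = rot u ` {0..2 * pi}"
    by auto
  have "continuous_on {0..2 * pi} (rot u)"
    by (intro continuous_on_rot continuous_on_const continuous_on_id)
  then show ?thesis
    unfolding eq by (rule compact_continuous_image) (rule compact_Icc)
qed

definition rot2 :: "real \<Rightarrow> real^2^2" where
  "rot2 t = vector [vector [cos t, - sin t], vector [sin t, cos t]]"

lemma rot2_mult: "rot2 s ** rot2 t = rot2 (s + t)"
  by (simp add: rot2_def matrix_matrix_mult_def vec_eq_iff forall_2 sum_2 cos_add sin_add)

lemma carrier_SO2: "carrier (SO :: (real^2^2) monoid) = range rot2"
proof (intro subset_antisym subsetI)
  fix B :: "real^2^2" assume "B \<in> carrier SO"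
  then have "transpose B ** B = mat 1" "det B = 1"
    by (auto simp: rotation_matrix_def orthogonal_matrix)
  then have o: "B$1$1 * B$1$1 + B$2$1 * B$2$1 = 1" "B$1$1 * B$1$2 + B$2$1 * B$2$2 = 0"
    and d: "B$1$1 * B$2$2 - B$1$2 * B$2$1 = 1"
    by (simp_all add: vec_eq_iff forall_2 matrix_matrix_mult_def sum_2 transpose_def mat_def det_2)
  have "B$2$2 = B$1$1" "B$1$2 = - B$2$1"
  proof -
    have "B$2$2 * (B$1$1 * B$1$1 + B$2$1 * B$2$1)
        = B$1$1 * (B$1$1 * B$2$2 - B$1$2 * B$2$1) + B$2$1 * (B$1$1 * B$1$2 + B$2$1 * B$2$2)"
      by (simp add: algebra_simps)
    then show "B$2$2 = B$1$1" by (simp add: o d)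
    have "B$1$2 * (B$1$1 * B$1$1 + B$2$1 * B$2$1)
        = B$1$1 * (B$1$1 * B$1$2 + B$2$1 * B$2$2) - B$2$1 * (B$1$1 * B$2$2 - B$1$2 * B$2$1)"
      by (simp add: algebra_simps)
    then show "B$1$2 = - B$2$1" by (simp add: o d)
  qed
  moreover obtain t where "B$1$1 = cos t" "B$2$1 = sin t"
    using o(1) sincos_total_2pi[of "B$1$1" "B$2$1"] unfolding power2_eq_square by blast
  ultimately have "B = rot2 t"
    by (simp add: rot2_def vec_eq_iff forall_2)
  then show "B \<in> range rot2" by simp
next
  fix B assume "B \<in> range rot2"
  then obtain t where B: "B = rot2 t" by auto
  have "cos t * cos t + sin t * sin t = 1"
    using sin_cos_squared_add[of t] by (simp add: power2_eq_square)
  then show "B \<in> carrier SO"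
    by (simp add: B rotation_matrix_def orthogonal_matrix det_2 rot2_def vec_eq_iff forall_2
        matrix_matrix_mult_def sum_2 transpose_def mat_def algebra_simps)
qed

lemma rotation_matrix_rot2: "rotation_matrix (rot2 t)"
  using carrier_SO2 by (metis SO_simps(3) rangeI)

text \<open>For a unit vector \<open>e\<close> orthogonal to \<open>u\<close>, the isomorphism restricts a rotation about \<open>u\<close> to the
  plane spanned by \<open>e\<close> and \<open>u \<times> e\<close>. Its inverse is continuous because the circle group is
  compact.\<close>

lemma circle_iso_SO2:
  assumes "norm u = 1"
  obtains \<phi> \<psi> where "\<phi> \<in> iso (SO\<lparr>carrier := range (rot u)\<rparr>) (SO :: (real^2^2) monoid)"
    "homeomorphism (range (rot u)) (carrier SO) \<phi> \<psi>"
proof -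
  obtain e where e: "norm e = 1" "u \<bullet> e = 0"
    using sphere_orthogonal_exists by blast
  define f where "f = u \<times> e"
  note ff = cross_orthonormal[OF assms e, folded f_def]
  define \<phi> :: "real^3^3 \<Rightarrow> real^2^2" where
    "\<phi> A = vector [vector [e \<bullet> (A *v e), - (f \<bullet> (A *v e))], vector [f \<bullet> (A *v e), e \<bullet> (A *v e)]]" for A
  have \<phi>: "\<phi> (rot u t) = rot2 t" for t
    using e ff by (simp add: \<phi>_def rot2_def rot_apply inner_add_right dot_square_norm inner_commute
        flip: f_def)
  have inj: "inj_on \<phi> (range (rot u))"
  proof (rule inj_onI)
    fix A B assume "A \<in> range (rot u)" "B \<in> range (rot u)" "\<phi> A = \<phi> B"
    then obtain s t where st: "A = rot u s" "B = rot u t" "rot2 s = rot2 t"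
      by (auto simp: \<phi>)
    from st(3) have "cos s = cos t" "sin s = sin t"
      by (auto simp: rot2_def vec_eq_iff forall_2)
    then show "A = B" by (simp add: st rot_def)
  qed
  have img: "\<phi> ` range (rot u) = carrier SO"
    by (simp add: carrier_SO2 image_image \<phi>)
  have lin: "linear \<phi>"
    by (rule linearI)
      (simp_all add: \<phi>_def vec_eq_iff forall_2 matrix_vector_mult_add_rdistrib inner_add_right
        scaleR_matrix_vector_assoc[symmetric])
  have "continuous_on (range (rot u)) \<phi>"
    using lin linear_continuous_on linear_conv_bounded_linear by blast
  then obtain \<psi> where "homeomorphism (range (rot u)) (carrier SO) \<phi> \<psi>"
    using homeomorphism_compact[OF compact_circle[OF assms] _ img inj] by blast
  moreover have "\<phi> \<in> iso (SO\<lparr>carrier := range (rot u)\<rparr>) SO"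
  proof (rule isoI)
    show "\<phi> \<in> hom (SO\<lparr>carrier := range (rot u)\<rparr>) SO"
      by (intro homI) (auto simp: rot_mult[OF assms] \<phi> rot2_mult rotation_matrix_rot2)
    show "bij_betw \<phi> (carrier (SO\<lparr>carrier := range (rot u)\<rparr>)) (carrier SO)"
      using inj img by (simp add: bij_betw_def)
  qed
  ultimately show ?thesis
    using that by blast
qed

text \<open>The antisymmetric part of the quarter turn about \<open>u\<close> is \<open>x \<mapsto> u \<times> x\<close>, and this map determines
  \<open>u\<close>, including its sign.\<close>

lemma rot_inj_axis:
  assumes "norm u = 1" "norm w = 1" "rot u (pi / 2) = rot w (pi / 2)"
  shows "u = w"
proof -
  have "rot u (- (pi / 2)) = rot w (- (pi / 2))"
    by (metis assms(3) transpose_rot)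
  then have "rot u (pi / 2) *v x - rot u (- (pi / 2)) *v x
      = rot w (pi / 2) *v x - rot w (- (pi / 2)) *v x" for x
    by (simp add: assms(3))
  then have "2 *\<^sub>R (u \<times> x) = 2 *\<^sub>R (w \<times> x)" for x
    by (simp add: rot_apply scaleR_2)
  then have *: "(u - w) \<times> x = 0" for x
    by (simp add: Cross3.left_diff_distrib)
  obtain e where e: "norm e = 1" "(u - w) \<bullet> e = 0"
    using sphere_orthogonal_exists by blast
  show ?thesis
    using norm_and_cross_eq_0[of "u - w" e] * e by auto
qed

text \<open>By continuity \<open>A\<close> commutes with the closure of \<open>G\<close>, in particular with the quarter turn about
  \<open>u\<close>. The conjugate by \<open>A\<close> of this quarter turn is the quarter turn about \<open>A u\<close>.\<close>

lemma commutative_fixes_axis: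
  assumes "subgroup G SO3" and "norm u = 1" and circle: "\<And>t. rot u t \<in> closure G"
    and comm: "\<And>A B. A \<in> G \<Longrightarrow> B \<in> G \<Longrightarrow> A ** B = B ** A" and "A \<in> G"
  shows "A *v u = u"
proof -
  have A: "rotation_matrix A"
    using subgroup_SOD(1)[OF assms(1)] assms(5) .
  have "A ** B = B ** A" if B: "B \<in> closure G" for B
  proof -
    obtain f where f: "\<forall>n::nat. f n \<in> G" "f \<longlonglongrightarrow> B"
      using B by (auto simp: closure_sequential)
    have "(\<lambda>n. A ** f n) \<longlonglongrightarrow> A ** B" "(\<lambda>n. f n ** A) \<longlonglongrightarrow> B ** A"
      by (intro tendsto_intros f)+
    moreover have "(\<lambda>n. A ** f n) = (\<lambda>n. f n ** A)"
      using comm assms(5) f(1) by auto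
    ultimately show ?thesis
      by (metis LIMSEQ_unique)
  qed
  then have "rot (A *v u) (pi / 2) = rot u (pi / 2) ** A ** transpose A"
    using circle[of "pi / 2"] rot_conj[OF A, of u "pi / 2"] by metis
  also have "\<dots> = rot u (pi / 2)"
    by (simp add: rotation_matrix_transpose_mult(2)[OF A] flip: matrix_mul_assoc)
  finally show ?thesis
    using rot_inj_axis[of "A *v u" u] assms(2) A by (simp add: rotation_matrix_norm)
qed

section \<open>Subgroups that preserve a line\<close>

text \<open>The axis \<open>v\<close> of \<open>A\<close> is orthogonal to \<open>u\<close>, because \<open>v \<bullet> u = A v \<bullet> A u = - (v \<bullet> u)\<close>. So
  \<open>u \<bullet> A u = -1\<close> is the cosine of the angle of \<open>A\<close>, and \<open>A\<close> is a half-turn.\<close>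

lemma flip_involution:
  fixes A :: "real^3^3"
  assumes "rotation_matrix A" and "norm u = 1" and "A *v u = - u"
  shows "A ** A = mat 1"
proof -
  obtain v t where v: "norm v = 1" "0 \<le> t" "t \<le> pi" "A = rot v t"
    using rotation_is_rot[OF assms(1)] .
  have "v \<bullet> u = - (v \<bullet> u)"
    using rotation_matrix_inner[OF assms(1), of v u] assms(3) v(1,4) rot_fixes by simp
  then have "v \<bullet> u = 0" by simp
  then have "u \<bullet> (A *v u) = cos t"
    using assms(2) by (simp add: v(4) rot_apply inner_add_right dot_cross_self dot_square_norm)
  then have "cos t = - 1"
    using assms(2,3) by (simp add: dot_square_norm)
  then have "t = pi"
    using v(2,3) by (metis arccos_cos arccos_minus_1)
  then show ?thesis
    using rot_periodic[of v 0] by (simp add: v(1,4) rot_mult)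
qed

lemma flip_axis_orthogonal:
  fixes A :: "real^3^3"
  assumes "rotation_matrix A" and "A *v u = - u" and "A *v x = x"
  shows "x \<bullet> u = 0"
  using rotation_matrix_inner[OF assms(1), of x u] assms(2,3) by simp

lemma rot_axis:
  assumes "norm u = 1" and "rot u t \<noteq> mat 1" and "rot u t *v x = x"
  shows "x = (u \<bullet> x) *\<^sub>R u"
proof -
  define y where "y = x - (u \<bullet> x) *\<^sub>R u"
  have "u \<bullet> y = 0"
    using assms(1) by (simp add: y_def inner_diff_right dot_square_norm)
  moreover have "rot u t *v y = y"
    using assms(3) rot_fixes[OF assms(1)]
    by (simp add: y_def matrix_vector_mult_diff_distrib matrix_vector_mult_scaleR)
  ultimately have *: "cos t *\<^sub>R y + sin t *\<^sub>R (u \<times> y) = y"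
    by (simp add: rot_apply)
  then have "y \<bullet> (cos t *\<^sub>R y + sin t *\<^sub>R (u \<times> y)) = y \<bullet> y"
    by simp
  then have "cos t * (y \<bullet> y) = y \<bullet> y"
    by (simp add: inner_add_right dot_cross_self)
  moreover have "cos t \<noteq> 1"
  proof
    assume "cos t = 1"
    then have "sin t = 0" using sin_cos_squared_add[of t] by simp
    then show False
      using assms(2) \<open>cos t = 1\<close> rot_0[of u] by (simp add: rot_def)
  qed
  ultimately show ?thesis
    by (simp add: y_def)
qed

text \<open>Conjugation by the half-turn \<open>A\<close> inverts the rotations about \<open>u\<close>.\<close>

lemma dihedral_subgroup:
  assumes "subgroup S SO3" and circle: "S \<subseteq> range (rot u)" and u: "norm u = 1"
    and A: "rotation_matrix A" "A *v u = - u"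
  shows "subgroup (S \<union> (\<lambda>s. A ** s) ` S) SO"
proof -
  note S = subgroup_SOD[OF assms(1)]
  have AA: "A ** A = mat 1"
    using flip_involution[OF A(1) u A(2)] .
  then have AT: "transpose A = A"
    using rotation_matrix_transpose_mult(2)[OF A(1)]
    by (metis matrix_mul_assoc matrix_mul_lid matrix_mul_rid)
  have swap: "s ** A = A ** transpose s" if s: "s \<in> S" for s
  proof -
    obtain t where t: "s = rot u t"
      using s circle by auto
    have "A ** s ** A = transpose s"
      using rot_conj[OF A(1), of u t] by (simp add: t A AT rot_neg transpose_rot)
    then show ?thesis
      by (metis AA matrix_mul_assoc matrix_mul_lid)
  qed
  have SA: "s ** (A ** s') = A ** (transpose s ** s')" if "s \<in> S" for s s'
    using swap[OF that] by (simp add: matrix_mul_assoc)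
  have AA': "A ** (A ** X) = X" for X
    by (simp add: matrix_mul_assoc AA)
  show ?thesis
  proof (rule subgroup_SOI)
    show "rotation_matrix X" if "X \<in> S \<union> (\<lambda>s. A ** s) ` S" for X
      using that A S by (auto intro: rotation_matrix_closed)
    show "mat 1 \<in> S \<union> (\<lambda>s. A ** s) ` S"
      using S by auto
    show "X ** Y \<in> S \<union> (\<lambda>s. A ** s) ` S"
      if "X \<in> S \<union> (\<lambda>s. A ** s) ` S" "Y \<in> S \<union> (\<lambda>s. A ** s) ` S" for X Y
      using that S(3,4) by (auto simp: matrix_mul_assoc[symmetric] SA AA')
    show "transpose X \<in> S \<union> (\<lambda>s. A ** s) ` S" if "X \<in> S \<union> (\<lambda>s. A ** s) ` S" for X
      using that S(4) swap[OF S(4)] by (auto simp: matrix_transpose_mul AT)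
  qed
qed

text \<open>If \<open>B\<close> had finite order, then the finite set that consists of the powers of \<open>B\<close> and of their
  products with \<open>A\<close> would be a subgroup that contains both generators.\<close>

lemma dihedral_generators:
  assumes A: "rotation_matrix A" "A *v u = - u" and B: "rotation_matrix B" "B *v u = u"
    and u: "norm u = 1" and inf: "infinite (generate SO {A, B})"
  shows "group.ord SO A = 2" "group.ord SO B = 0"
    "\<forall>x\<in>rotation_axis A. \<forall>y\<in>rotation_axis B. orthogonal x y"
proof -
  interpret group SO3 by (rule group_SO)
  have carr: "A \<in> carrier SO" "B \<in> carrier SO"
    using A B by simp_all
  have "A [^]\<^bsub>SO\<^esub> (2::nat) = \<one>\<^bsub>SO\<^esub>"
    using flip_involution[OF A(1) u A(2)] A(1) by (simp add: numeral_2_eq_2)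
  then have "ord A dvd 2"
    using pow_eq_id[OF carr(1)] by blast
  moreover have "A \<noteq> mat 1"
  proof
    assume "A = mat 1"
    then have "u = - u"
      using A(2) by simp
    then have "u \<bullet> u = - (u \<bullet> u)"
      by (metis inner_minus_right)
    then show False
      using u by (simp add: dot_square_norm)
  qed
  then have "ord A \<noteq> 1"
    using ord_eq_1[OF carr(1)] by simp
  ultimately show "ord A = 2"
    by (metis prime_nat_iff two_is_prime_nat)
  show ordB: "ord B = 0"
  proof (rule ccontr)
    assume "ord B \<noteq> 0"
    define S where "S = generate SO {B}"
    have fin: "finite S"
      using generate_pow_card[OF carr(2)] \<open>ord B \<noteq> 0\<close> by (auto simp: S_def intro: card_ge_0_finite)
    have "subgroup S SO"
      unfolding S_def using carr by (intro subgroup_generate_SO) simp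
    moreover have "S \<subseteq> range (rot u)"
      unfolding S_def using B
      by (intro generate_subgroup_incl subgroup_circle u) (simp add: circle_eq_stabilizer[OF u])
    ultimately have "subgroup (S \<union> (\<lambda>s. A ** s) ` S) SO"
      using dihedral_subgroup A u by blast
    moreover have "B \<in> S" "mat 1 \<in> S"
      using subgroup_SOD(2)[OF \<open>subgroup S SO\<close>] by (auto simp: S_def intro: generate.incl)
    then have "{A, B} \<subseteq> S \<union> (\<lambda>s. A ** s) ` S"
      by force
    ultimately have "generate SO {A, B} \<subseteq> S \<union> (\<lambda>s. A ** s) ` S"
      by (rule generate_subgroup_incl[rotated])
    then show False
      using inf fin by (meson finite_UnI finite_imageI finite_subset)
  qed
  obtain t where t: "B = rot u t"
    using rotation_with_fixed_vector_is_rot[OF B(1) u B(2)] by blast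
  have "B \<noteq> mat 1"
    using ordB ord_id by auto
  show "\<forall>x\<in>rotation_axis A. \<forall>y\<in>rotation_axis B. orthogonal x y"
  proof (intro ballI)
    fix x y assume "x \<in> rotation_axis A" "y \<in> rotation_axis B"
    then have "x \<bullet> u = 0" "y = (u \<bullet> y) *\<^sub>R u"
      using flip_axis_orthogonal[OF A] rot_axis[OF u, of t] \<open>B \<noteq> mat 1\<close>
      by (simp_all add: rotation_axis_def t)
    then show "orthogonal x y"
      unfolding orthogonal_def by (metis inner_scaleR_right mult_zero_right)
  qed
qed

section \<open>Subgroups with two generators\<close>

lemma generate_SO_pair_cong:
  assumes "A \<in> carrier SO3" "B \<in> carrier SO"
  shows "generate SO {A, A ** B} = generate SO {A, B}"
proof (rule subset_antisym)
  interpret group SO3 by (rule group_SO)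
  have AB: "A ** B \<in> carrier SO"
    using assms by (auto intro: rotation_matrix_closed)
  have 1: "subgroup (generate SO {A, B}) SO" "subgroup (generate SO {A, A ** B}) SO"
    using assms AB by (auto intro!: subgroup_generate_SO simp del: SO_simps)
  have "A ** B \<in> generate SO {A, B}"
    using subgroup_SOD(3)[OF 1(1)] by (auto intro: generate.incl)
  then show "generate SO {A, A ** B} \<subseteq> generate SO {A, B}"
    by (intro generate_subgroup_incl 1) (auto intro: generate.incl)
  have "transpose A ** (A ** B) \<in> generate SO {A, A ** B}"
    by (intro subgroup_SOD(3)[OF 1(2) subgroup_SOD(4)[OF 1(2)]]) (auto intro: generate.incl)
  moreover have "transpose A ** (A ** B) = B"
    using assms by (simp add: matrix_mul_assoc rotation_matrix_transpose_mult)
  ultimately have "B \<in> generate SO {A, A ** B}"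
    by simp
  then have "{A, B} \<subseteq> generate SO {A, A ** B}"
    by (auto intro: generate.incl)
  then show "generate SO {A, B} \<subseteq> generate SO {A, A ** B}"
    by (intro generate_subgroup_incl 1)
qed

text \<open>If \<open>G\<close> is infinite, its closure contains the circle group of some unit vector \<open>u\<close>. A commutative
  \<open>G\<close> fixes \<open>u\<close>; otherwise \<open>G\<close> is dense or generated by a half-turn and a rotation of infinite
  order, according to whether it moves the line \<open>\<real>u\<close>.\<close>

lemma two_generator_subgroup_SO3:
  assumes C: "C1 \<in> carrier SO3" "C2 \<in> carrier SO3" and G: "G = generate SO {C1, C2}"
  shows "finite G \<or>
     (infinite G \<and> comm_group (SO\<lparr>carrier := G\<rparr>) \<and>
       (\<exists>S. S \<subseteq> carrier SO \<and> (card S = 1 \<or> card S = 2) \<and> G = generate SO S) \<and>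
       (\<exists>H. subgroup H SO \<and> G \<subseteq> H \<and> H \<subseteq> closure G \<and>
          (\<exists>\<phi> \<psi>. \<phi> \<in> iso (SO\<lparr>carrier := H\<rparr>) (SO :: (real^2^2) monoid) \<and>
             homeomorphism H (carrier SO) \<phi> \<psi>))) \<or>
     (infinite G \<and> \<not> comm_group (SO\<lparr>carrier := G\<rparr>) \<and>
       (\<exists>A\<in>carrier SO. \<exists>B\<in>carrier SO. G = generate SO {A, B} \<and>
          group.ord SO A = 2 \<and> group.ord SO B = 0 \<and>
          (\<forall>u\<in>rotation_axis A. \<forall>w\<in>rotation_axis B. orthogonal u w))) \<or>
     (infinite G \<and> \<not> comm_group (SO\<lparr>carrier := G\<rparr>) \<and> carrier SO \<subseteq> closure G)"
proof (cases "finite G")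
  case False
  have sub: "subgroup G SO"
    unfolding G using C by (intro subgroup_generate_SO) (simp del: SO_simps)
  obtain u where u: "norm u = 1" "\<And>t. rot u t \<in> closure G"
    using closure_contains_circle[OF sub False] by blast
  show ?thesis
  proof (cases "comm_group (SO\<lparr>carrier := G\<rparr>)")
    case True
    then have "A *v u = u" if "A \<in> G" for A
      using commutative_fixes_axis[OF sub u] that comm_group_subgroup_SO_iff[OF sub] by blast
    then have "G \<subseteq> range (rot u)"
      using subgroup_SOD(1)[OF sub] by (auto simp: circle_eq_stabilizer[OF u(1)])
    moreover have "range (rot u) \<subseteq> closure G"
      using u by auto
    moreover obtain \<phi> \<psi> where "\<phi> \<in> iso (SO\<lparr>carrier := range (rot u)\<rparr>) (SO :: (real^2^2) monoid)"
      "homeomorphism (range (rot u)) (carrier SO) \<phi> \<psi>"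
      using circle_iso_SO2[OF u(1)] .
    ultimately have H: "\<exists>H. subgroup H SO \<and> G \<subseteq> H \<and> H \<subseteq> closure G \<and>
        (\<exists>\<phi> \<psi>. \<phi> \<in> iso (SO\<lparr>carrier := H\<rparr>) (SO :: (real^2^2) monoid) \<and>
           homeomorphism H (carrier SO) \<phi> \<psi>)"
      by (intro exI[of _ "range (rot u)"] conjI subgroup_circle u(1)) auto
    have "card {C1, C2} = 1 \<or> card {C1, C2} = 2"
      by (cases "C1 = C2") auto
    moreover have "{C1, C2} \<subseteq> carrier SO"
      using C by (simp del: SO_simps)
    ultimately have "\<exists>S. S \<subseteq> carrier SO \<and> (card S = 1 \<or> card S = 2) \<and> G = generate SO S"
      using G by blast
    then show ?thesis
      using True False H by simp
  next
    case noncomm: False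
    show ?thesis
    proof (cases "\<forall>A\<in>G. A *v u = u \<or> A *v u = - u")
      case False
      then obtain A where A: "A \<in> G" "A *v u \<noteq> u" "A *v u \<noteq> - u"
        by blast
      have rA: "rotation_matrix A"
        using subgroup_SOD(1)[OF sub A(1)] .
      note K = subgroup_SOD[OF subgroup_closure[OF sub]]
      have "A \<in> closure G"
        using A(1) closure_subset by blast
      then have "rot (A *v u) t \<in> closure G" for t
        using u(2) by (simp add: K flip: rot_conj[OF rA])
      then have "carrier SO \<subseteq> closure G"
        using two_circles_generate_SO3[OF subgroup_closure[OF sub] closed_closure u, of "A *v u"]
          A rA u(1) by (simp add: rotation_matrix_norm)
      then show ?thesis
        using noncomm \<open>infinite G\<close> by blast
    next
      case line: True
      have "C1 \<in> G" "C2 \<in> G"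
        by (auto simp: G intro: generate.incl)
      \<comment> \<open>If both generators reverse \<open>u\<close>, the second one is replaced by their product.\<close>
      have gens: "\<exists>A\<in>carrier SO. \<exists>B\<in>carrier SO. G = generate SO {A, B} \<and> A *v u = - u \<and> B *v u = u"
        if flip: "A *v u = - u" and gen: "G = generate SO {A, B}"
          and carr: "A \<in> carrier SO" "B \<in> carrier SO" and "B \<in> G" for A B
      proof (cases "B *v u = u")
        case False
        then have "B *v u = - u"
          using line \<open>B \<in> G\<close> by blast
        then have "(A ** B) *v u = u"
          using flip linear_neg[OF matrix_vector_mul_linear, of A u]
          by (simp flip: matrix_vector_mul_assoc)
        moreover have "A ** B \<in> carrier SO"
          using carr by (auto intro: rotation_matrix_closed)
        ultimately show ?thesis
          using generate_SO_pair_cong[OF carr] gen flip carr(1) by blast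
      next
        case True
        then show ?thesis
          using gen flip carr by blast
      qed
      have "C1 *v u = - u \<or> C2 *v u = - u"
      proof (rule ccontr)
        assume "\<not> ?thesis"
        then have "{C1, C2} \<subseteq> range (rot u)"
          using line C \<open>C1 \<in> G\<close> \<open>C2 \<in> G\<close> by (auto simp: circle_eq_stabilizer[OF u(1)])
        then have "G \<subseteq> range (rot u)"
          unfolding G using group.generate_subgroup_incl[OF group_SO] subgroup_circle[OF u(1)]
          by blast
        then have "A ** B = B ** A" if AB: "A \<in> G" "B \<in> G" for A B
        proof -
          obtain s t where "A = rot u s" "B = rot u t"
            using AB \<open>G \<subseteq> range (rot u)\<close> by blast
          then show ?thesis
            by (simp add: rot_mult[OF u(1)] add.commute)
        qed
        then show False
          using noncomm comm_group_subgroup_SO_iff[OF sub] by blast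
      qed
      moreover have "G = generate SO {C2, C1}"
        using G by (simp only: insert_commute)
      ultimately have "\<exists>A\<in>carrier SO. \<exists>B\<in>carrier SO.
          G = generate SO {A, B} \<and> A *v u = - u \<and> B *v u = u"
        using gens[OF _ G C] gens[OF _ _ C(2) C(1)] \<open>C1 \<in> G\<close> \<open>C2 \<in> G\<close> by blast
      then obtain A B where AB: "A \<in> carrier SO" "B \<in> carrier SO" "G = generate SO {A, B}"
        "A *v u = - u" "B *v u = u"
        by blast
      then have "group.ord SO A = 2" "group.ord SO B = 0"
        "\<forall>x\<in>rotation_axis A. \<forall>y\<in>rotation_axis B. orthogonal x y"
        using dihedral_generators[of A u B] u(1) \<open>infinite G\<close> by simp_all
      then show ?thesis
        using noncomm \<open>infinite G\<close> AB by blast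
    qed
  qed
qed blast

unbundle no cross3_syntax

theorem theorem7p6:
  fixes E :: "(4, 'v::real_vector) vbundle"
    and h :: "'v metric" and hh :: "'v ext2 metric"
    and D :: "'v connection" and DD :: "'v ext2 connection"
    and \<epsilon> :: real and \<omega> :: "3 \<Rightarrow> 'v ext2" and G :: "(real^3^3) set"
  assumes "oriented_bundle4 E"
    and "bundle_metric E h"
    and "induced_metric E h hh"
    and "metric_connection E h D"
    and "induced_connection E D DD"
    and "\<epsilon> = 1 \<or> \<epsilon> = -1"
    and "positive_orthonormal_half_basis E h hh \<epsilon> (pr (0, 0)) \<omega>"
    and "topological_holonomy_group E h DD \<epsilon> \<omega> G"
  shows "subgroup G SO \<and>
    (finite G \<or>
     (infinite G \<and> comm_group (SO\<lparr>carrier := G\<rparr>) \<and>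
       (\<exists>S. S \<subseteq> carrier SO \<and> (card S = 1 \<or> card S = 2) \<and> G = generate SO S) \<and>
       (\<exists>H. subgroup H SO \<and> G \<subseteq> H \<and> H \<subseteq> closure G \<and>
          (\<exists>\<phi> \<psi>. \<phi> \<in> iso (SO\<lparr>carrier := H\<rparr>) (SO :: (real^2^2) monoid) \<and>
             homeomorphism H (carrier SO) \<phi> \<psi>))) \<or>
     (infinite G \<and> \<not> comm_group (SO\<lparr>carrier := G\<rparr>) \<and>
       (\<exists>A\<in>carrier SO. \<exists>B\<in>carrier SO. G = generate SO {A, B} \<and>
          group.ord SO A = 2 \<and> group.ord SO B = 0 \<and>
          (\<forall>u\<in>rotation_axis A. \<forall>w\<in>rotation_axis B. orthogonal u w))) \<or>
     (infinite G \<and> \<not> comm_group (SO\<lparr>carrier := G\<rparr>) \<and> carrier SO \<subseteq> closure G))"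
proof -
  obtain C1 C2 where C: "C1 \<in> carrier SO3" "C2 \<in> carrier SO3" "G = generate SO {C1, C2}"
    using assms(8) unfolding topological_holonomy_group_def by blast
  moreover have "subgroup G SO"
    unfolding C(3) using C by (intro subgroup_generate_SO) (simp del: SO_simps)
  ultimately show ?thesis
    using two_generator_subgroup_SO3 by (intro conjI)
qed

end
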